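(* Let $s\in\mathbb{N}$, and let $c_s>0$ be a number such that $c_s/(n+|k|)^s\le\tilde e(n,k,s)$ for all $k\in\mathbb{Z}$ and $n\in\mathbb{N}$. Consider the normalized error criterion for the integration problem $I_k$ over the periodic space $\widetilde H^s$. For all $k\in\mathbb{Z}$, $k\neq0$, and all $\varepsilon\in(0,1)$ we have $$|k|\left(2\pi\left(\frac{c_s}{\varepsilon}\right)^{1/s}-1\right)\le\tilde n^{\rm nor}(\varepsilon,k,s)\le|k|\left\lceil3\left(\frac{\sqrt2}{\varepsilon}\right)^{1/s}-1\right\rceil,$$ which can be written as $$\tilde n^{\rm nor}(\varepsilon,k,s)=\Theta\left(\frac{|k|}{\varepsilon^{1/s}}\right)\qquad\text{as }\varepsilon\to0.$$
   Context: For $s\in\mathbb{N}=\{1,2,\dots\}$ let $H^s=\{f:[0,1]\to\mathbb{C} : f^{(s-1)}\text{ is absolutely continuous},\ f^{(s)}\in L_2([0,1])\}$ with inner product $$\langle f,g\rangle_s=\sum_{\ell=0}^{s-1}\int_0^1 f^{(\ell)}(x)\,dx\ \int_0^1\overline{g^{(\ell)}(x)}\,dx+\int_0^1 f^{(s)}(x)\,\overline{g^{(s)}(x)}\,dx$$ and norm $\|f\|_{H^s}=\langle f,f\rangle_s^{1/2}$. The periodic subspace is $\widetilde H^s=\{f\in H^s : f^{(\ell)}(0)=f^{(\ell)}(1)\text{ for }\ell=0,1,\dots,s-1\}$ with the same inner product. For $k\in\mathbb{Z}$, $I_k(f)=\int_0^1 f(x)\,e^{-2\pi i kx}\,dx$.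 Algorithms using $n$ values have the form $A_n(f)=\sum_{j=1}^n a_j f^{(\ell_j)}(x_j)$ with $a_j\in\mathbb{C}$, $\ell_j\in\{0,\dots,s-1\}$, $x_j\in[0,1]$; for $n=0$ the only algorithm is $A_0=0$. Set $\tilde e(A_n)=\sup\{|I_k(f)-A_n(f)| : f\in\widetilde H^s,\ \|f\|_{H^s}\le1\}$ and $\tilde e(n,k,s)=\inf_{A_n}\tilde e(A_n)$. A number $c_s>0$ depending only on $s$ with $c_s/(n+|k|)^s\le\tilde e(n,k,s)$ for all $k\in\mathbb{Z}$, $n\in\mathbb{N}$ is known to exist. The information complexity for the normalized error criterion is $\tilde n^{\rm nor}(\varepsilon,k,s)=\min\{n\in\{0,1,2,\dots\} : \tilde e(n,k,s)\le\varepsilon\,\tilde e(0,k,s)\}$. In the $\Theta$-statement the implied constants depend only on $s$, and the two-sided bound holds for all sufficiently small $\varepsilon$ (for each fixed $s$ and $k$). *)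

theory Defs
  imports "HOL-Analysis.Analysis"
begin

text \<open>Functions on $[0,1]$ are represented by functions of type \<open>real \<Rightarrow> complex\<close>; every notion
  below depends only on the values on \<open>{0..1}\<close>. Derivatives at the end points are one-sided.\<close>

definition nderiv :: "nat \<Rightarrow> (real \<Rightarrow> complex) \<Rightarrow> real \<Rightarrow> complex" where
  "nderiv l = (\<lambda>f x. vector_derivative f (at x within {0..1})) ^^ l"

definition abs_continuous_on_interval :: "real \<Rightarrow> real \<Rightarrow> (real \<Rightarrow> 'a::real_normed_vector) \<Rightarrow> bool" where
  "abs_continuous_on_interval a b f \<longleftrightarrow>
     (\<forall>\<epsilon>>0. \<exists>\<delta>>0. \<forall>(m::nat) u v.
        (\<forall>i<m. a \<le> u i \<and> u i \<le> v i \<and> v i \<le> b) \<longrightarrow>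
        disjoint_family_on (\<lambda>i. {u i<..<v i}) {..<m} \<longrightarrow>
        (\<Sum>i<m. v i - u i) < \<delta> \<longrightarrow>
        (\<Sum>i<m. norm (f (v i) - f (u i))) < \<epsilon>)"

definition square_integrable01 :: "(real \<Rightarrow> complex) \<Rightarrow> bool" where
  "square_integrable01 g \<longleftrightarrow>
     g \<in> borel_measurable (lebesgue_on {0..1}) \<and>
     integrable (lebesgue_on {0..1}) (\<lambda>x. (cmod (g x))\<^sup>2)"

text \<open>The almost-everywhere differentiability of \<open>nderiv (s - 1) f\<close> follows from absolute
  continuity by Lebesgue's theorem. It is listed because \<^const>\<open>vector_derivative\<close> is total: it
  says that \<open>nderiv s f\<close> is the derivative of \<open>nderiv (s - 1) f\<close> almost everywhere.\<close>

definition sobolev :: "nat \<Rightarrow> (real \<Rightarrow> complex) set" where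
  "sobolev s = {f.
     (\<forall>l. Suc l < s \<longrightarrow> (\<forall>x\<in>{0..1}. nderiv l f differentiable (at x within {0..1}))) \<and>
     abs_continuous_on_interval 0 1 (nderiv (s - 1) f) \<and>
     (AE x in lebesgue_on {0..1}. nderiv (s - 1) f differentiable (at x within {0..1})) \<and>
     square_integrable01 (nderiv s f)}"

definition sobolev_inner :: "nat \<Rightarrow> (real \<Rightarrow> complex) \<Rightarrow> (real \<Rightarrow> complex) \<Rightarrow> complex" where
  "sobolev_inner s f g =
     (\<Sum>l<s. (LINT x|lebesgue_on {0..1}. nderiv l f x) *
             (LINT x|lebesgue_on {0..1}. cnj (nderiv l g x))) +
     (LINT x|lebesgue_on {0..1}. nderiv s f x * cnj (nderiv s g x))"

definition sobolev_norm :: "nat \<Rightarrow> (real \<Rightarrow> complex) \<Rightarrow> real" where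
  "sobolev_norm s f = sqrt (Re (sobolev_inner s f f))"

definition periodic_sobolev :: "nat \<Rightarrow> (real \<Rightarrow> complex) set" where
  "periodic_sobolev s = {f \<in> sobolev s. \<forall>l<s. nderiv l f 0 = nderiv l f 1}"

definition fourier_integral :: "int \<Rightarrow> (real \<Rightarrow> complex) \<Rightarrow> complex" where
  "fourier_integral k f =
     (LINT x|lebesgue_on {0..1}. f x * exp (- 2 * of_real pi * \<i> * of_int k * of_real x))"

definition algorithms :: "nat \<Rightarrow> nat \<Rightarrow> ((real \<Rightarrow> complex) \<Rightarrow> complex) set" where
  "algorithms s n = {A. \<exists>(a :: nat \<Rightarrow> complex) (l :: nat \<Rightarrow> nat) (x :: nat \<Rightarrow> real).
     (\<forall>j\<in>{1..n}. l j < s \<and> x j \<in> {0..1}) \<and>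
     A = (\<lambda>f. \<Sum>j=1..n. a j * nderiv (l j) f (x j))}"

text \<open>Suprema and infima of errors are taken in \<^typ>\<open>ereal\<close>, so that no boundedness side condition
  is needed for them to have their usual meaning.\<close>

definition worst_case_error ::
  "nat \<Rightarrow> int \<Rightarrow> ((real \<Rightarrow> complex) \<Rightarrow> complex) \<Rightarrow> ereal" where
  "worst_case_error s k A =
     (SUP f\<in>{f \<in> periodic_sobolev s. sobolev_norm s f \<le> 1}.
        ereal (cmod (fourier_integral k f - A f)))"

definition minimal_error :: "nat \<Rightarrow> int \<Rightarrow> nat \<Rightarrow> ereal" where
  "minimal_error n k s = (INF A\<in>algorithms s n. worst_case_error s k A)"

definition info_complexity_nor :: "real \<Rightarrow> int \<Rightarrow> nat \<Rightarrow> nat" where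
  "info_complexity_nor \<epsilon> k s =
     (LEAST n. minimal_error n k s \<le> ereal \<epsilon> * minimal_error 0 k s)"

end

theory Submission
  imports Defs
begin

text \<open>
  The initial error is exactly $(2\pi|k|)^{-s}$. Integrating by parts \<open>s\<close> times, the \<open>k\<close>-th Fourier
  coefficient of a periodic $f$ is that of $f^{(s)}$ divided by $(2\pi ik)^s$, which gives the upper
  bound, and a multiple of $e^{2\pi ikx}$ attains it (\<open>minimal_error_0\<close>). The lower bound on the
  complexity is then the assumed inequality $c/(n+|k|)^s\le\tilde e(n,k,s)$ solved for \<open>n\<close>.

  For the upper bound, apply the rectangle rule with $n=m|k|$ equispaced nodes to
  $f(x)e^{-2\pi ikx}$. The nodes cannot distinguish the frequencies $k+hn$, and the error is the sum of
  the Fourier coefficients of $f$ at these frequencies for $h\ne0$ (\<open>quadrature_aliasing\<close>). By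
  Cauchy--Schwarz it is at most $\|f^{(s)}\|_{L_2}\bigl(\sum_{h\ne0}(2\pi|k+hn|)^{-2s}\bigr)^{1/2}$
  (\<open>quadrature_error_le\<close>). If $m\ge3$, then $|k+hn|\ge|k||h|(m+1)/2$, and the error is at most
  $2(2/(m+1))^s\le\sqrt2\,(3/(m+1))^s$ times the initial error (\<open>alias_sum_le\<close>, \<open>minimal_error_le\<close>).
  This is at most \<open>\<epsilon>\<close> times the initial error as soon as $m+1\ge3(\sqrt2/\varepsilon)^{1/s}$.

  Two analytic facts carry these computations. The derivative of order \<open>s\<close> exists only almost everywhere,
  so integration by parts needs the fundamental theorem of calculus for absolutely continuous functions
  (\<open>fundamental_theorem_of_calculus_abs_continuous\<close>). And the aliasing formula needs the Fourier series of
  a periodic absolutely continuous function with square integrable derivative to converge at the end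
  point (\<open>fourier_series_at_endpoint\<close>); this reduces to the $L_2$-convergence of the Fourier series of
  one function, the sawtooth $x-\frac12$, which is the Basel sum.
\<close>

section \<open>The fundamental theorem of calculus for absolutely continuous functions\<close>

text \<open>The pieces of a tagged division come as a finite set of pairs and not as an enumeration,
  which is how the next theorem has to address them.\<close>

lemma abs_continuous_on_interval_finite:
  fixes F :: "real \<Rightarrow> 'a::real_normed_vector"
  assumes AC: "abs_continuous_on_interval a b F" and "e > 0"
  shows "\<exists>d>0. \<forall>(J::'b set) u v. finite J \<longrightarrow> (\<forall>i\<in>J. a \<le> u i \<and> u i \<le> v i \<and> v i \<le> b) \<longrightarrow>
           disjoint_family_on (\<lambda>i. {u i<..<v i}) J \<longrightarrow> (\<Sum>i\<in>J. v i - u i) < d \<longrightarrow>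
           (\<Sum>i\<in>J. norm (F (v i) - F (u i))) < e"
proof -
  obtain d where d: "d > 0" and dAC: "\<forall>(m::nat) u v.
        (\<forall>i<m. a \<le> u i \<and> u i \<le> v i \<and> v i \<le> b) \<longrightarrow>
        disjoint_family_on (\<lambda>i. {u i<..<v i}) {..<m} \<longrightarrow>
        (\<Sum>i<m. v i - u i) < d \<longrightarrow>
        (\<Sum>i<m. norm (F (v i) - F (u i))) < e"
    using AC \<open>e > 0\<close> unfolding abs_continuous_on_interval_def by blast
  show ?thesis
  proof (intro exI [of _ d] conjI allI impI)
    fix J :: "'b set" and u v
    assume J: "finite J" and uv: "\<forall>i\<in>J. a \<le> u i \<and> u i \<le> v i \<and> v i \<le> b"
      and disj: "disjoint_family_on (\<lambda>i. {u i<..<v i}) J" and small: "(\<Sum>i\<in>J. v i - u i) < d"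
    obtain h where h: "bij_betw h {..<card J} J"
      using J ex_bij_betw_nat_finite lessThan_atLeast0 by metis
    then have hJ: "h i \<in> J" if "i < card J" for i
      using that bij_betwE by blast
    have "(\<Sum>i<card J. norm (F (v (h i)) - F (u (h i)))) < e"
    proof (rule dAC [rule_format])
      show "a \<le> u (h i) \<and> u (h i) \<le> v (h i) \<and> v (h i) \<le> b" if "i < card J" for i
        using uv hJ that by blast
      show "disjoint_family_on (\<lambda>i. {u (h i)<..<v (h i)}) {..<card J}"
        unfolding disjoint_family_on_def
      proof (intro ballI impI)
        fix i j assume "i \<in> {..<card J}" "j \<in> {..<card J}" "i \<noteq> j"
        then have "h i \<noteq> h j" "h i \<in> J" "h j \<in> J"
          using h hJ by (auto simp: bij_betw_def inj_on_def)
        then show "{u (h i)<..<v (h i)} \<inter> {u (h j)<..<v (h j)} = {}"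
          using disj unfolding disjoint_family_on_def by blast
      qed
      show "(\<Sum>i<card J. v (h i) - u (h i)) < d"
        using small sum.reindex_bij_betw [OF h, of "\<lambda>i. v i - u i"] by simp
    qed
    then show "(\<Sum>i\<in>J. norm (F (v i) - F (u i))) < e"
      using sum.reindex_bij_betw [OF h, of "\<lambda>i. norm (F (v i) - F (u i))"] by simp
  qed (fact d)
qed

text \<open>The gauge treats the two kinds of tags differently. At a point of differentiability it is the
  usual ball on which the increment of \<open>F\<close> is close to its linear part. At a point of the exceptional
  set \<open>N\<close> it is an open neighbourhood \<open>U\<close> of \<open>N\<close> of small measure: the intervals tagged in \<open>N\<close> then have
  small total length, and absolute continuity makes the increments of \<open>F\<close> over them negligible.\<close>

theorem fundamental_theorem_of_calculus_abs_continuous: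
  fixes F :: "real \<Rightarrow> 'a::banach"
  assumes ab: "a \<le> b" and AC: "abs_continuous_on_interval a b F" and N: "negligible N"
    and der: "\<And>x. x \<in> {a..b} - N \<Longrightarrow> (F has_vector_derivative F' x) (at x within {a..b})"
  shows "(F' has_integral (F b - F a)) {a..b}"
proof -
  define G where "G = (\<lambda>x. if x \<in> N then 0 else F' x)"
  have "(G has_integral (F b - F a)) {a..b}"
    unfolding has_integral_real [where a=a]
  proof (intro allI impI)
    fix e :: real assume "e > 0"
    \<comment> \<open>The error \<open>e\<close> is shared equally by the two kinds of tags; the \<open>+ 1\<close> covers \<open>a = b\<close>.\<close>
    define e1 where "e1 = e / 2 / (b - a + 1)"
    have e1: "e1 > 0" using \<open>e > 0\<close> ab by (auto simp: e1_def)
    have "\<exists>d>0. x \<in> {a..b} - N \<longrightarrow>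
         (\<forall>y\<in>{a..b}. norm (y-x) < d \<longrightarrow> norm (F y - F x - (y-x) *\<^sub>R F' x) \<le> e1 * norm (y-x))" for x
    proof (cases "x \<in> {a..b} - N")
      case True
      then show ?thesis
        using der[unfolded has_vector_derivative_def has_derivative_within_alt] e1 by blast
    qed (auto intro: exI [of _ 1])
    then obtain \<delta> where \<delta>: "\<And>x. \<delta> x > 0"
        "\<And>x y. \<lbrakk>x \<in> {a..b}; x \<notin> N; y \<in> {a..b}; norm (y-x) < \<delta> x\<rbrakk>
            \<Longrightarrow> norm (F y - F x - (y-x) *\<^sub>R F' x) \<le> e1 * norm (y-x)"
      by (metis DiffI)
    obtain d where "d > 0" and d:
        "\<forall>(J::(real \<times> real set) set) u v. finite J \<longrightarrow> (\<forall>i\<in>J. a \<le> u i \<and> u i \<le> v i \<and> v i \<le> b) \<longrightarrow>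
           disjoint_family_on (\<lambda>i. {u i<..<v i}) J \<longrightarrow> (\<Sum>i\<in>J. v i - u i) < d \<longrightarrow>
           (\<Sum>i\<in>J. norm (F (v i) - F (u i))) < e/2"
      using abs_continuous_on_interval_finite [OF AC half_gt_zero [OF \<open>e > 0\<close>]] by blast
    have nullN: "N \<in> null_sets lebesgue"
      using N by (simp add: negligible_iff_null_sets)
    then obtain U where U: "open U" "N \<subseteq> U" "U - N \<in> lmeasurable" "emeasure lebesgue (U - N) < ennreal d"
      using sets_lebesgue_outer_open [of N d] \<open>d > 0\<close> by blast
    have Ulm: "U \<in> lmeasurable" and "measure lebesgue U < d"
    proof -
      have eq: "emeasure lebesgue U = emeasure lebesgue (U - N)"
        using nullN U(1) by (simp add: emeasure_Diff_null_set)
      then have "emeasure lebesgue U < ennreal d" using U(4) by simp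
      then show "U \<in> lmeasurable"
        using U(1) by (intro fmeasurableI) (auto intro: less_trans)
      then show "measure lebesgue U < d"
        using \<open>emeasure lebesgue U < ennreal d\<close> \<open>d > 0\<close>
        by (simp add: emeasure_eq_measure2 ennreal_less_iff)
    qed
    define \<gamma> where "\<gamma> = (\<lambda>x. if x \<in> N then U else ball x (\<delta> x))"
    have "norm ((\<Sum>(x, K)\<in>p. measure lborel K *\<^sub>R G x) - (F b - F a)) < e"
      if ptag: "p tagged_division_of {a..b}" and fine: "\<gamma> fine p" for p
    proof -
      have finp: "finite p" using ptag by blast
      have sub: "K \<subseteq> {a..b}" "x \<in> K" "Inf K \<le> Sup K" "K = {Inf K..Sup K}" "measure lborel K = Sup K - Inf K"
           "Inf K \<in> K" "Sup K \<in> K" "K \<subseteq> \<gamma> x"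
        if pK: "(x,K) \<in> p" for x K
      proof -
        show xK: "x \<in> K" "K \<subseteq> {a..b}" "K \<subseteq> \<gamma> x" using ptag fine pK unfolding fine_def by blast+
        obtain u v where K: "K = {u..v}" using tagged_division_ofD(4) [OF ptag pK] by (auto simp: box_real)
        then have "u \<le> v" using xK by auto
        then show "Inf K \<le> Sup K" "K = {Inf K..Sup K}" "measure lborel K = Sup K - Inf K"
          "Inf K \<in> K" "Sup K \<in> K"
          by (auto simp: K)
      qed
      have ba: "b - a = (\<Sum>(x,K)\<in>p. Sup K - Inf K)" "F b - F a = (\<Sum>(x,K)\<in>p. F(Sup K) - F(Inf K))"
        using additive_tagged_division_1[where f= "\<lambda>x. x"] additive_tagged_division_1[where f= F]
              ab ptag by auto
      define p1 where "p1 = {i \<in> p. fst i \<in> N}"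
      define p2 where "p2 = {i \<in> p. fst i \<notin> N}"
      have p12: "p = p1 \<union> p2" "p1 \<inter> p2 = {}" "finite p1" "finite p2"
        using finp by (auto simp: p1_def p2_def)
      have "norm (\<Sum>(x, K)\<in>p2. measure lborel K *\<^sub>R G x - (F (Sup K) - F (Inf K)))
           \<le> (\<Sum>(x,K)\<in>p2. e1 * (Sup K - Inf K))"
      proof (rule sum_norm_le, safe)
        fix x K assume "(x,K) \<in> p2"
        then have p: "(x,K) \<in> p" and xN: "x \<notin> N" by (auto simp: p2_def)
        define u v where "u = Inf K" and "v = Sup K"
        note s = sub[OF p, folded u_def v_def]
        have xuv: "u \<le> x" "x \<le> v" using s(2,4) by auto
        have near: "norm (u - x) < \<delta> x" "norm (v - x) < \<delta> x"
          using s(6,7,8) xN by (auto simp: \<gamma>_def dist_real_def)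
        have xab: "x \<in> {a..b}" "u \<in> {a..b}" "v \<in> {a..b}" using s by blast+
        have "norm ((v - u) *\<^sub>R F' x - (F v - F u)) = norm (F u - F x - (u - x) *\<^sub>R F' x - (F v - F x - (v - x) *\<^sub>R F' x))"
          by (simp add: algebra_simps)
        also have "\<dots> \<le> norm (F u - F x - (u - x) *\<^sub>R F' x) + norm (F v - F x - (v - x) *\<^sub>R F' x)"
          by (rule norm_triangle_ineq4)
        also have "\<dots> \<le> e1 * norm (u - x) + e1 * norm (v - x)"
          using \<delta>(2)[OF xab(1) xN] xab near by (intro add_mono) auto
        also have "\<dots> = e1 * (v - u)"
          using xuv by (simp add: algebra_simps)
        finally show "norm (measure lborel K *\<^sub>R G x - (F (Sup K) - F (Inf K))) \<le> e1 * (Sup K - Inf K)"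
          using xN s(5) by (simp add: G_def u_def v_def)
      qed
      also have "\<dots> \<le> (\<Sum>(x,K)\<in>p. e1 * (Sup K - Inf K))"
        using finp sub(3) e1 by (intro sum_mono2) (auto simp: p2_def)
      also have "\<dots> = e1 * (b - a)"
        by (simp add: ba sum_distrib_left case_prod_unfold)
      also have "\<dots> < e / 2"
        using ab \<open>e > 0\<close> by (simp add: e1_def field_simps)
      finally have A: "norm (\<Sum>(x, K)\<in>p2. measure lborel K *\<^sub>R G x - (F (Sup K) - F (Inf K))) < e / 2" .
      have disj: "disjoint_family_on (\<lambda>i. {Inf (snd i)<..<Sup (snd i)}) p1"
        unfolding disjoint_family_on_def
      proof (intro ballI impI)
        fix i j assume ij: "i \<in> p1" "j \<in> p1" "i \<noteq> j"
        obtain x K y L where eq: "i = (x,K)" "j = (y,L)" by fastforce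
        with ij have p: "(x,K) \<in> p" "(y,L) \<in> p" "(x,K) \<noteq> (y,L)" by (auto simp: p1_def)
        have "interior K \<inter> interior L = {}" using tagged_division_ofD(5)[OF ptag p] .
        moreover have "interior K = {Inf K<..<Sup K}" "interior L = {Inf L<..<Sup L}"
          using sub(4)[OF p(1)] sub(4)[OF p(2)] by (metis interior_atLeastAtMost_real)+
        ultimately show "{Inf (snd i)<..<Sup (snd i)} \<inter> {Inf (snd j)<..<Sup (snd j)} = {}"
          by (simp add: eq)
      qed
      have "(\<Sum>i\<in>p1. Sup (snd i) - Inf (snd i)) = (\<Sum>i\<in>p1. measure lebesgue {Inf (snd i)<..<Sup (snd i)})"
        using sub(3) by (intro sum.cong) (auto simp: p1_def)
      also have "\<dots> = measure lebesgue (\<Union>i\<in>p1. {Inf (snd i)<..<Sup (snd i)})"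
        using disj p12 emeasure_bounded_finite [OF bounded_Ioo]
        by (intro measure_finite_Union [symmetric]) (auto simp: less_top)
      also have "\<dots> \<le> measure lebesgue U"
      proof (intro measure_mono_fmeasurable Ulm)
        have "{Inf K<..<Sup K} \<subseteq> U" if "(x,K) \<in> p1" for x K
        proof -
          have "(x,K) \<in> p" "x \<in> N" using that by (auto simp: p1_def)
          then have "K \<subseteq> U" "K = {Inf K..Sup K}" using sub(8,4) [of x K] by (simp_all add: \<gamma>_def)
          then show ?thesis using greaterThanLessThan_subseteq_atLeastAtMost_iff by fastforce
        qed
        then show "(\<Union>i\<in>p1. {Inf (snd i)<..<Sup (snd i)}) \<subseteq> U" by fastforce
      qed (use p12 in \<open>auto intro!: sets.finite_UN\<close>)
      also have "\<dots> < d" by fact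
      finally have "(\<Sum>i\<in>p1. norm (F (Sup (snd i)) - F (Inf (snd i)))) < e / 2"
      proof (intro d [rule_format])
        show "a \<le> Inf (snd i) \<and> Inf (snd i) \<le> Sup (snd i) \<and> Sup (snd i) \<le> b" if "i \<in> p1" for i
          using that sub(1,3,6,7) [of "fst i" "snd i"] by (auto simp: p1_def)
      qed (use disj p12 in auto)
      moreover have "norm (\<Sum>(x, K)\<in>p1. measure lborel K *\<^sub>R G x - (F (Sup K) - F (Inf K)))
            \<le> (\<Sum>i\<in>p1. norm (F (Sup (snd i)) - F (Inf (snd i))))"
        by (rule sum_norm_le) (auto simp: p1_def G_def norm_minus_commute)
      ultimately have B: "norm (\<Sum>(x, K)\<in>p1. measure lborel K *\<^sub>R G x - (F (Sup K) - F (Inf K))) < e / 2"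
        by linarith
      have "(\<Sum>(x, K)\<in>p. measure lborel K *\<^sub>R G x) - (F b - F a)
           = (\<Sum>(x, K)\<in>p. measure lborel K *\<^sub>R G x - (F (Sup K) - F (Inf K)))"
        by (simp add: ba sum_subtractf case_prod_unfold)
      also have "\<dots> = (\<Sum>(x, K)\<in>p1. measure lborel K *\<^sub>R G x - (F (Sup K) - F (Inf K)))
           + (\<Sum>(x, K)\<in>p2. measure lborel K *\<^sub>R G x - (F (Sup K) - F (Inf K)))"
        using p12 by (simp add: sum.union_disjoint)
      finally show ?thesis
        using A B norm_triangle_ineq by (smt (verit) field_sum_of_halves)
    qed
    moreover have "gauge \<gamma>"
      using U \<delta>(1) by (auto simp: gauge_def \<gamma>_def)
    ultimately show "\<exists>\<gamma>. gauge \<gamma> \<and> (\<forall>\<D>. \<D> tagged_division_of {a..b} \<and> \<gamma> fine \<D> \<longrightarrow>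
             norm ((\<Sum>(x, k)\<in>\<D>. measure lborel k *\<^sub>R G x) - (F b - F a)) < e)"
      by blast
  qed
  then show ?thesis
    by (rule has_integral_spike [OF N, rotated]) (auto simp: G_def)
qed

section \<open>Absolutely continuous functions with an almost everywhere derivative\<close>

lemma abs_continuous_imp_continuous_on:
  assumes "abs_continuous_on_interval a b F"
  shows "continuous_on {a..b} F"
  unfolding continuous_on_iff
proof (intro ballI allI impI)
  fix x and e :: real assume x: "x \<in> {a..b}" and "e > 0"
  obtain d where "d > 0" and d:
        "\<forall>(J::nat set) u v. finite J \<longrightarrow> (\<forall>i\<in>J. a \<le> u i \<and> u i \<le> v i \<and> v i \<le> b) \<longrightarrow>
           disjoint_family_on (\<lambda>i. {u i<..<v i}) J \<longrightarrow> (\<Sum>i\<in>J. v i - u i) < d \<longrightarrow>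
           (\<Sum>i\<in>J. norm (F (v i) - F (u i))) < e"
    using abs_continuous_on_interval_finite [OF assms \<open>e > 0\<close>] by blast
  have "dist (F y) (F x) < e" if "y \<in> {a..b}" "dist y x < d" for y
  proof -
    have "(\<Sum>i\<in>{0::nat}. norm (F (max x y) - F (min x y))) < e"
      using x that by (intro d [rule_format]) (auto simp: dist_real_def disjoint_family_on_def)
    then show ?thesis
      by (auto simp: dist_norm max_def min_def norm_minus_commute split: if_splits)
  qed
  then show "\<exists>d>0. \<forall>x'\<in>{a..b}. dist x' x < d \<longrightarrow> dist (F x') (F x) < e"
    using \<open>d > 0\<close> by blast
qed

text \<open>The increments of a sum, and those of a product with a Lipschitz factor, are dominated by the
  increments of two absolutely continuous functions, so this one criterion covers both.\<close>

lemma abs_continuous_dominated: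
  fixes F :: "real \<Rightarrow> 'a::real_normed_vector"
  assumes F1: "abs_continuous_on_interval a b F1" and F2: "abs_continuous_on_interval a b F2"
    and "C > 0"
    and le: "\<And>u v. \<lbrakk>a \<le> u; u \<le> v; v \<le> b\<rbrakk> \<Longrightarrow>
        norm (F v - F u) \<le> C * (norm (F1 v - F1 u) + norm (F2 v - F2 u))"
  shows "abs_continuous_on_interval a b F"
  unfolding abs_continuous_on_interval_def
proof (intro allI impI)
  fix e :: real assume "e > 0"
  then have e': "e / (2 * C) > 0" using \<open>C > 0\<close> by simp
  obtain d1 where "d1 > 0" and d1:
        "\<forall>(m::nat) u v. (\<forall>i<m. a \<le> u i \<and> u i \<le> v i \<and> v i \<le> b) \<longrightarrow>
           disjoint_family_on (\<lambda>i. {u i<..<v i}) {..<m} \<longrightarrow> (\<Sum>i<m. v i - u i) < d1 \<longrightarrow>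
           (\<Sum>i<m. norm (F1 (v i) - F1 (u i))) < e / (2 * C)"
    using F1 e' unfolding abs_continuous_on_interval_def by blast
  obtain d2 where "d2 > 0" and d2:
        "\<forall>(m::nat) u v. (\<forall>i<m. a \<le> u i \<and> u i \<le> v i \<and> v i \<le> b) \<longrightarrow>
           disjoint_family_on (\<lambda>i. {u i<..<v i}) {..<m} \<longrightarrow> (\<Sum>i<m. v i - u i) < d2 \<longrightarrow>
           (\<Sum>i<m. norm (F2 (v i) - F2 (u i))) < e / (2 * C)"
    using F2 e' unfolding abs_continuous_on_interval_def by blast
  have "(\<Sum>i<m. norm (F (v i) - F (u i))) < e"
    if uv: "\<forall>i<m. a \<le> u i \<and> u i \<le> v i \<and> v i \<le> b" and disj: "disjoint_family_on (\<lambda>i. {u i<..<v i}) {..<m}"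
      and small: "(\<Sum>i<m. v i - u i) < min d1 d2" for m :: nat and u v
  proof -
    have s1: "(\<Sum>i<m. norm (F1 (v i) - F1 (u i))) < e / (2 * C)"
      and s2: "(\<Sum>i<m. norm (F2 (v i) - F2 (u i))) < e / (2 * C)"
      using d1 [rule_format, OF _ disj] d2 [rule_format, OF _ disj] uv small by auto
    have "(\<Sum>i<m. norm (F (v i) - F (u i)))
        \<le> (\<Sum>i<m. C * (norm (F1 (v i) - F1 (u i)) + norm (F2 (v i) - F2 (u i))))"
      using uv by (intro sum_mono le) auto
    also have "\<dots> = C * ((\<Sum>i<m. norm (F1 (v i) - F1 (u i))) + (\<Sum>i<m. norm (F2 (v i) - F2 (u i))))"
      by (simp add: sum.distrib flip: sum_distrib_left)
    also have "\<dots> < C * (e / (2 * C) + e / (2 * C))"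
      using s1 s2 \<open>C > 0\<close> by (intro mult_strict_left_mono) auto
    also have "\<dots> = e" using \<open>C > 0\<close> by simp
    finally show ?thesis .
  qed
  then show "\<exists>\<delta>>0. \<forall>(m::nat) u v. (\<forall>i<m. a \<le> u i \<and> u i \<le> v i \<and> v i \<le> b) \<longrightarrow>
        disjoint_family_on (\<lambda>i. {u i<..<v i}) {..<m} \<longrightarrow>
        (\<Sum>i<m. v i - u i) < \<delta> \<longrightarrow> (\<Sum>i<m. norm (F (v i) - F (u i))) < e"
    using \<open>d1 > 0\<close> \<open>d2 > 0\<close> by (intro exI [of _ "min d1 d2"]) auto
qed

lemma abs_continuous_id: "abs_continuous_on_interval a b (\<lambda>x::real. x)"
  unfolding abs_continuous_on_interval_def
proof (intro allI impI)
  fix e :: real assume "e > 0"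
  have "(\<Sum>i<m. norm (v i - u i)) < e"
    if "\<forall>i<m. a \<le> u i \<and> u i \<le> v i \<and> v i \<le> b" "(\<Sum>i<m. v i - u i) < e" for m :: nat and u v
  proof -
    have "(\<Sum>i<m. norm (v i - u i)) = (\<Sum>i<m. v i - u i)"
      using that(1) by (intro sum.cong) auto
    with that show ?thesis by simp
  qed
  then show "\<exists>\<delta>>0. \<forall>(m::nat) u v. (\<forall>i<m. a \<le> u i \<and> u i \<le> v i \<and> v i \<le> b) \<longrightarrow>
        disjoint_family_on (\<lambda>i. {u i<..<v i}) {..<m} \<longrightarrow>
        (\<Sum>i<m. v i - u i) < \<delta> \<longrightarrow> (\<Sum>i<m. norm (v i - u i)) < e"
    using \<open>e > 0\<close> by (intro exI [of _ e]) blast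
qed

lemma abs_continuous_affine:
  assumes F: "abs_continuous_on_interval 0 1 F" and "j < n"
  shows "abs_continuous_on_interval 0 1 (\<lambda>x. F ((x + real j) / real n))"
  unfolding abs_continuous_on_interval_def
proof (intro allI impI)
  have n: "real n \<ge> 1" "real j + 1 \<le> real n" using \<open>j < n\<close> by auto
  fix e :: real assume "e > 0"
  obtain d where "d > 0" and d:
        "\<forall>(m::nat) u v. (\<forall>i<m. 0 \<le> u i \<and> u i \<le> v i \<and> v i \<le> 1) \<longrightarrow>
           disjoint_family_on (\<lambda>i. {u i<..<v i}) {..<m} \<longrightarrow> (\<Sum>i<m. v i - u i) < d \<longrightarrow>
           (\<Sum>i<m. norm (F (v i) - F (u i))) < e"
    using F \<open>e > 0\<close> unfolding abs_continuous_on_interval_def by blast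
  have "(\<Sum>i<m. norm (F ((v i + real j) / real n) - F ((u i + real j) / real n))) < e"
    if uv: "\<forall>i<m. 0 \<le> u i \<and> u i \<le> v i \<and> v i \<le> 1" and disj: "disjoint_family_on (\<lambda>i. {u i<..<v i}) {..<m}"
      and small: "(\<Sum>i<m. v i - u i) < d" for m :: nat and u v
  proof (rule d [rule_format])
    show "0 \<le> (u i + real j) / real n \<and> (u i + real j) / real n \<le> (v i + real j) / real n \<and>
         (v i + real j) / real n \<le> 1" if "i < m" for i
      using uv [rule_format, OF that] n by (auto simp: divide_right_mono)
    have scale: "y * real n - real j \<in> {u i<..<v i}"
      if "y \<in> {(u i + real j) / real n<..<(v i + real j) / real n}" for y i
      using that n by (auto simp: field_simps)
    show "disjoint_family_on (\<lambda>i. {(u i + real j) / real n<..<(v i + real j) / real n}) {..<m}"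
      using disj scale unfolding disjoint_family_on_def by (meson disjoint_iff)
    have "(\<Sum>i<m. (v i + real j) / real n - (u i + real j) / real n) = (\<Sum>i<m. v i - u i) / real n"
      by (simp add: sum_divide_distrib diff_divide_distrib add_divide_distrib)
    also have "\<dots> \<le> (\<Sum>i<m. v i - u i)"
    proof -
      have "0 \<le> (\<Sum>i<m. v i - u i)" using uv by (intro sum_nonneg) auto
      then show ?thesis using n divide_left_mono [of 1 "real n" "\<Sum>i<m. v i - u i"] by simp
    qed
    finally show "(\<Sum>i<m. (v i + real j) / real n - (u i + real j) / real n) < d"
      using small by simp
  qed
  then show "\<exists>\<delta>>0. \<forall>(m::nat) u v. (\<forall>i<m. 0 \<le> u i \<and> u i \<le> v i \<and> v i \<le> 1) \<longrightarrow>
        disjoint_family_on (\<lambda>i. {u i<..<v i}) {..<m} \<longrightarrow> (\<Sum>i<m. v i - u i) < \<delta> \<longrightarrow>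
        (\<Sum>i<m. norm (F ((v i + real j) / real n) - F ((u i + real j) / real n))) < e"
    using \<open>d > 0\<close> by blast
qed

text \<open>The derivative is a separate argument because it is determined only almost everywhere, and
  the values on the exceptional set must be free: they are those of \<^const>\<open>vector_derivative\<close> at points
  where it has no meaning.\<close>

definition ac_deriv :: "(real \<Rightarrow> complex) \<Rightarrow> (real \<Rightarrow> complex) \<Rightarrow> bool" where
  "ac_deriv F F' \<longleftrightarrow> abs_continuous_on_interval 0 1 F \<and>
     (\<exists>N. negligible N \<and> (\<forall>x\<in>{0..1}-N. (F has_vector_derivative F' x) (at x within {0..1})))"

lemma ac_deriv_has_integral:
  "ac_deriv F F' \<Longrightarrow> (F' has_integral (F 1 - F 0)) {0..1}"
  unfolding ac_deriv_def using fundamental_theorem_of_calculus_abs_continuous [of 0 1 F _ F'] by auto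

lemma ac_deriv_continuous_on: "ac_deriv F F' \<Longrightarrow> continuous_on {0..1} F"
  using abs_continuous_imp_continuous_on by (auto simp: ac_deriv_def)

lemma ac_deriv_const: "ac_deriv (\<lambda>x. c) (\<lambda>x. 0)"
  unfolding ac_deriv_def abs_continuous_on_interval_def
  by (auto intro!: exI [of _ 1] exI [of _ "{}"])

lemma ac_deriv_add:
  assumes "ac_deriv F F'" "ac_deriv G G'"
  shows "ac_deriv (\<lambda>x. F x + G x) (\<lambda>x. F' x + G' x)"
proof -
  obtain M N where "negligible M" "\<forall>x\<in>{0..1}-M. (F has_vector_derivative F' x) (at x within {0..1})"
     "negligible N" "\<forall>x\<in>{0..1}-N. (G has_vector_derivative G' x) (at x within {0..1})"
    using assms unfolding ac_deriv_def by blast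
  then have "negligible (M \<union> N) \<and>
      (\<forall>x\<in>{0..1}-(M \<union> N). ((\<lambda>x. F x + G x) has_vector_derivative F' x + G' x) (at x within {0..1}))"
    by (auto intro!: negligible_Un derivative_intros)
  moreover have "abs_continuous_on_interval 0 1 (\<lambda>x. F x + G x)"
  proof (rule abs_continuous_dominated [of 0 1 F G 1])
    show "norm (F v + G v - (F u + G u)) \<le> 1 * (norm (F v - F u) + norm (G v - G u))" for u v
      using norm_triangle_ineq [of "F v - F u" "G v - G u"] by (simp add: algebra_simps)
  qed (use assms in \<open>auto simp: ac_deriv_def\<close>)
  ultimately show ?thesis unfolding ac_deriv_def by blast
qed

lemma ac_deriv_sum:
  assumes "finite J" "\<And>j. j \<in> J \<Longrightarrow> ac_deriv (F j) (F' j)"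
  shows "ac_deriv (\<lambda>x. \<Sum>j\<in>J. F j x) (\<lambda>x. \<Sum>j\<in>J. F' j x)"
  using assms by (induction J rule: finite_induct) (auto intro: ac_deriv_const ac_deriv_add)

lemma ac_deriv_mult:
  assumes F: "ac_deriv F F'"
    and w: "\<And>x. x \<in> {0..1} \<Longrightarrow> (w has_vector_derivative w' x) (at x within {0..1})"
    and w': "continuous_on {0..1} w'"
  shows "ac_deriv (\<lambda>x. F x * w x) (\<lambda>x. F x * w' x + F' x * w x)"
proof -
  obtain N where "negligible N" "\<forall>x\<in>{0..1}-N. (F has_vector_derivative F' x) (at x within {0..1})"
    using F unfolding ac_deriv_def by blast
  then have "\<exists>N. negligible N \<and>
      (\<forall>x\<in>{0..1}-N. ((\<lambda>x. F x * w x) has_vector_derivative F x * w' x + F' x * w x) (at x within {0..1}))"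
    using w by (intro exI [of _ N]) (auto intro!: has_vector_derivative_mult)
  moreover
  have "continuous_on {0..1} w" 
    using w has_vector_derivative_continuous continuous_on_eq_continuous_within by blast
  then have "bounded (w ` {0..1})" "bounded (F ` {0..1})" "bounded (w' ` {0..1})"
    using w' ac_deriv_continuous_on [OF F]
    by (auto intro!: compact_imp_bounded compact_continuous_image)
  then obtain A B L where AB: "A > 0" "B > 0" "L > 0" and
    bds: "\<forall>x\<in>{0..1}. norm (w x) \<le> A" "\<forall>x\<in>{0..1}. norm (F x) \<le> B" "\<forall>x\<in>{0..1}. norm (w' x) \<le> L"
    unfolding bounded_pos by auto
  have Lip: "norm (w v - w u) \<le> L * norm (v - u)" if "u \<in> {0..1}" "v \<in> {0..1}" for u v
  proof (rule differentiable_bound [of "{0..1}" w "\<lambda>x h. h *\<^sub>R w' x"])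
    show "(w has_derivative (\<lambda>h. h *\<^sub>R w' x)) (at x within {0..1})" if "x \<in> {0..1}" for x
      using w [OF that] by (simp add: has_vector_derivative_def)
    show "onorm (\<lambda>h. h *\<^sub>R w' x) \<le> L" if "x \<in> {0..1}" for x
      using bds(3) that by (intro onorm_le) (auto simp: mult.commute [of L] mult_left_mono)
  qed (use that in auto)
  have "abs_continuous_on_interval 0 1 (\<lambda>x. F x * w x)"
  proof (rule abs_continuous_dominated [of 0 1 F "\<lambda>x. x" "A + B * L"])
    fix u v :: real assume uv: "0 \<le> u" "u \<le> v" "v \<le> 1"
    have "norm (F v * w v - F u * w u) = norm ((F v - F u) * w v + F u * (w v - w u))"
      by (simp add: algebra_simps)
    also have "\<dots> \<le> norm (F v - F u) * norm (w v) + norm (F u) * norm (w v - w u)"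
      by (metis norm_mult norm_triangle_ineq)
    also have "\<dots> \<le> norm (F v - F u) * A + B * (L * norm (v - u))"
      using uv bds AB Lip [of u v] by (intro add_mono mult_mono) auto
    also have "\<dots> \<le> norm (F v - F u) * (A + B * L) + (A + B * L) * norm (v - u)"
      using AB by (intro add_mono mult_left_mono) (auto simp: algebra_simps)
    finally show "norm (F v * w v - F u * w u) \<le> (A + B * L) * (norm (F v - F u) + norm (v - u))"
      by (simp add: algebra_simps)
  qed (use F AB in \<open>auto simp: ac_deriv_def abs_continuous_id add_pos_pos\<close>)
  ultimately show ?thesis unfolding ac_deriv_def by blast
qed

lemma ac_deriv_continuously_differentiable:
  assumes "\<And>x. x \<in> {0..1} \<Longrightarrow> (w has_vector_derivative w' x) (at x within {0..1})"
    and "continuous_on {0..1} w'"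
  shows "ac_deriv w w'"
  using ac_deriv_mult [OF ac_deriv_const [of 1] assms] by simp

text \<open>The affine maps carry \<open>[0,1]\<close> onto the \<open>n\<close> cells between neighbouring quadrature nodes; they
  serve to fold a function on \<open>[0,1]\<close> onto a single cell.\<close>

lemma ac_deriv_affine:
  assumes F: "ac_deriv F F'" and "j < n"
  shows "ac_deriv (\<lambda>x. F ((x + real j) / real n)) (\<lambda>x. F' ((x + real j) / real n) / real n)"
proof -
  have n: "real n \<ge> 1" "real j + 1 \<le> real n" using \<open>j < n\<close> by auto
  define h where "h = (\<lambda>x. (x + real j) / real n)"
  obtain N where N: "negligible N" "\<forall>x\<in>{0..1}-N. (F has_vector_derivative F' x) (at x within {0..1})"
    using F unfolding ac_deriv_def by blast
  define M where "M = (\<lambda>y. real n * y - real j) ` N"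
  have "negligible M"
    unfolding M_def by (intro negligible_differentiable_image_negligible N derivative_intros) auto
  moreover have "((\<lambda>x. F (h x)) has_vector_derivative F' (h x) / real n) (at x within {0..1})"
    if x: "x \<in> {0..1} - M" for x
  proof -
    have "real n * h x - real j = x" using n by (simp add: h_def)
    then have hx: "h x \<in> {0..1} - N" using x n
      by (auto simp: h_def M_def image_iff field_simps)
    have sub: "h ` {0..1} \<subseteq> {0..1}"
      using n by (auto simp: h_def field_simps)
    have "(h has_vector_derivative (1 / real n)) (at x within {0..1})"
      unfolding h_def using n
      by (auto intro!: derivative_eq_intros simp flip: has_real_derivative_iff_has_vector_derivative)
    then have "(F \<circ> h has_vector_derivative (1 / real n) *\<^sub>R F' (h x)) (at x within {0..1})"
      using N(2) hx sub has_vector_derivative_within_subset by (intro vector_diff_chain_within) blast+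
    then show ?thesis by (simp add: o_def scaleR_conv_of_real divide_inverse mult.commute)
  qed
  ultimately show ?thesis
    using F abs_continuous_affine [OF _ \<open>j < n\<close>, of F] unfolding ac_deriv_def h_def by blast
qed

section \<open>Square integrable functions on the unit interval\<close>

text \<open>Square integrability is phrased with the gauge integral: both conditions then survive affine
  substitutions at once, and measurability follows from integrability.\<close>

definition sq_int :: "(real \<Rightarrow> complex) \<Rightarrow> bool" where
  "sq_int g \<longleftrightarrow> g integrable_on {0..1} \<and> (\<lambda>x. (cmod (g x))\<^sup>2) integrable_on {0..1}"

definition l2norm :: "(real \<Rightarrow> complex) \<Rightarrow> real" where
  "l2norm g = sqrt (integral {0..1} (\<lambda>x. (cmod (g x))\<^sup>2))"

lemma l2norm_nonneg: "0 \<le> l2norm g"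
  by (cases "(\<lambda>x. (cmod (g x))\<^sup>2) integrable_on {0..1}")
     (auto simp: l2norm_def integral_nonneg not_integrable_integral)

lemma l2norm_squared: "sq_int g \<Longrightarrow> (l2norm g)\<^sup>2 = integral {0..1} (\<lambda>x. (cmod (g x))\<^sup>2)"
  by (simp add: l2norm_def sq_int_def integral_nonneg)

lemma sq_int_continuous: "continuous_on {0..1} g \<Longrightarrow> sq_int g"
  unfolding sq_int_def by (intro conjI integrable_continuous_interval continuous_intros)

lemma sq_int_measurable: "sq_int g \<Longrightarrow> g \<in> borel_measurable (lebesgue_on {0..1})"
  by (simp add: sq_int_def integrable_imp_measurable)

lemma square_integrable01_imp_sq_int:
  assumes "square_integrable01 g"
  shows "sq_int g"
proof -
  have m: "g \<in> borel_measurable (lebesgue_on {0..1})"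
    and i: "(\<lambda>x. (cmod (g x))\<^sup>2) integrable_on {0..1}"
    using assms by (auto simp: square_integrable01_def integrable_on_lebesgue_on)
  have i1: "(\<lambda>x. 1 + (cmod (g x))\<^sup>2) integrable_on {0..1}"
    using i by (intro integrable_add) auto
  have "cmod z \<le> 1 + (cmod z)\<^sup>2" for z :: complex
  proof -
    have "2 * cmod z \<le> 1 + (cmod z)\<^sup>2" using sum_squares_bound [of 1 "cmod z"] by simp
    then show ?thesis using norm_ge_zero [of z] by linarith
  qed
  then have "g absolutely_integrable_on {0..1}"
    using m i1 by (intro measurable_bounded_by_integrable_imp_absolutely_integrable) auto
  then show ?thesis using i by (simp add: sq_int_def absolutely_integrable_on_def)
qed

lemma sq_int_product:
  assumes "sq_int a" "sq_int b"
  shows "(\<lambda>x. a x * b x) absolutely_integrable_on {0..1}"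
proof (rule measurable_bounded_by_integrable_imp_absolutely_integrable)
  show "(\<lambda>x. a x * b x) \<in> borel_measurable (lebesgue_on {0..1})"
    using assms [THEN sq_int_measurable] by measurable
  show "(\<lambda>x. (cmod (a x))\<^sup>2 + (cmod (b x))\<^sup>2) integrable_on {0..1}"
    using assms by (auto simp: sq_int_def intro: integrable_add)
  show "cmod (a x * b x) \<le> (cmod (a x))\<^sup>2 + (cmod (b x))\<^sup>2" for x
  proof -
    have "0 \<le> cmod (a x) * cmod (b x)" by simp
    then show ?thesis
      using sum_squares_bound [of "cmod (a x)" "cmod (b x)"] unfolding norm_mult by linarith
  qed
qed simp

text \<open>There is no conjugate on \<open>b\<close> because the pairing is always with functions such as
  $e^{-2\pi i kx}$, where the conjugation is already part of the second factor.\<close>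

lemma Cauchy_Schwarz_sq_int:
  assumes a: "sq_int a" and b: "sq_int b"
  shows "cmod (integral {0..1} (\<lambda>x. a x * b x)) \<le> l2norm a * l2norm b"
proof -
  define A where "A = integral {0..1} (\<lambda>x. (cmod (a x))\<^sup>2)"
  define B where "B = integral {0..1} (\<lambda>x. (cmod (b x))\<^sup>2)"
  define X where "X = integral {0..1} (\<lambda>x. cmod (a x) * cmod (b x))"
  have iA: "(\<lambda>x. (cmod (a x))\<^sup>2) integrable_on {0..1}" and iB: "(\<lambda>x. (cmod (b x))\<^sup>2) integrable_on {0..1}"
    using a b by (auto simp: sq_int_def)
  have iX: "(\<lambda>x. cmod (a x) * cmod (b x)) integrable_on {0..1}"
    using sq_int_product [OF a b] by (simp add: absolutely_integrable_on_def norm_mult)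
  have A0: "A \<ge> 0" and X0: "X \<ge> 0"
    unfolding A_def X_def by (auto intro: integral_nonneg iA iX)
  have quad: "0 \<le> t\<^sup>2 * A - 2 * t * X + B" for t
  proof -
    have "((\<lambda>x. t\<^sup>2 * (cmod (a x))\<^sup>2 - (2 * t) * (cmod (a x) * cmod (b x)) + (cmod (b x))\<^sup>2)
        has_integral (t\<^sup>2 * A - (2 * t) * X + B)) {0..1}"
      unfolding A_def B_def X_def
      by (intro has_integral_add has_integral_diff has_integral_mult_right integrable_integral iA iB iX)
    moreover have "0 \<le> t\<^sup>2 * (cmod (a x))\<^sup>2 - (2 * t) * (cmod (a x) * cmod (b x)) + (cmod (b x))\<^sup>2" for x
      using zero_le_power2 [of "t * cmod (a x) - cmod (b x)"]
      by (simp add: power2_diff power_mult_distrib algebra_simps)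
    ultimately show ?thesis by (rule has_integral_nonneg)
  qed
  \<comment> \<open>A quadratic in \<open>t\<close> that is never negative has nonpositive discriminant; if its leading
      coefficient vanishes, it is affine and must be constant.\<close>
  have "X\<^sup>2 \<le> A * B"
  proof (cases "A = 0")
    case True
    have "X = 0"
    proof (rule ccontr)
      assume "X \<noteq> 0"
      then show False using quad [of "(B + 1) / (2 * X)"] True by (simp add: field_simps)
    qed
    then show ?thesis using True by simp
  next
    case False
    with A0 quad [of "X / A"] show ?thesis by (simp add: field_simps power2_eq_square)
  qed
  then have "X \<le> sqrt (A * B)" by (rule real_le_rsqrt)
  moreover have "cmod (integral {0..1} (\<lambda>x. a x * b x)) \<le> X"
    unfolding X_def using sq_int_product [OF a b] iX
    by (intro integral_norm_bound_integral) (auto simp: absolutely_integrable_on_def norm_mult)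
  ultimately show ?thesis
    by (simp add: l2norm_def A_def B_def real_sqrt_mult)
qed

lemma sq_int_add:
  assumes "sq_int a" "sq_int b"
  shows "sq_int (\<lambda>x. a x + b x)"
proof -
  have "(\<lambda>x. (cmod (a x + b x))\<^sup>2) absolutely_integrable_on {0..1}"
  proof (rule measurable_bounded_by_integrable_imp_absolutely_integrable)
    show "(\<lambda>x. (cmod (a x + b x))\<^sup>2) \<in> borel_measurable (lebesgue_on {0..1})"
      using assms [THEN sq_int_measurable] by measurable
    show "(\<lambda>x. 2 * (cmod (a x))\<^sup>2 + 2 * (cmod (b x))\<^sup>2) integrable_on {0..1}"
      using assms by (auto simp: sq_int_def intro: integrable_add integrable_on_mult_right)
    show "norm ((cmod (a x + b x))\<^sup>2) \<le> 2 * (cmod (a x))\<^sup>2 + 2 * (cmod (b x))\<^sup>2" for x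
    proof -
      have "(cmod (a x + b x))\<^sup>2 \<le> (cmod (a x) + cmod (b x))\<^sup>2"
        by (intro power_mono norm_triangle_ineq) auto
      also have "\<dots> \<le> 2 * (cmod (a x))\<^sup>2 + 2 * (cmod (b x))\<^sup>2"
        using sum_squares_bound [of "cmod (a x)" "cmod (b x)"] by (simp add: power2_sum)
      finally show ?thesis by simp
    qed
  qed simp
  then show ?thesis
    using assms by (auto simp: sq_int_def absolutely_integrable_on_def intro: integrable_add)
qed

lemma sq_int_sum:
  assumes "finite J" "\<And>j. j \<in> J \<Longrightarrow> sq_int (g j)"
  shows "sq_int (\<lambda>x. \<Sum>j\<in>J. g j x)"
  using assms
proof (induction J rule: finite_induct)
  case empty
  show ?case by (simp add: sq_int_continuous)
next
  case (insert j J)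
  then have "sq_int (\<lambda>x. g j x + (\<Sum>i\<in>J. g i x))" by (intro sq_int_add) auto
  with insert show ?case by simp
qed

lemma sq_int_mult_continuous:
  assumes a: "sq_int a" and w: "continuous_on {0..1} w"
  shows "sq_int (\<lambda>x. a x * w x)"
proof -
  obtain B where B: "\<forall>x\<in>{0..1}. cmod (w x) \<le> B"
    using compact_imp_bounded [OF compact_continuous_image [OF w]] by (auto simp: bounded_iff)
  have "(\<lambda>x. (cmod (a x * w x))\<^sup>2) absolutely_integrable_on {0..1}"
  proof (rule measurable_bounded_by_integrable_imp_absolutely_integrable)
    show "(\<lambda>x. (cmod (a x * w x))\<^sup>2) \<in> borel_measurable (lebesgue_on {0..1})"
      using sq_int_measurable [OF a] sq_int_measurable [OF sq_int_continuous [OF w]] by measurable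
    show "(\<lambda>x. B\<^sup>2 * (cmod (a x))\<^sup>2) integrable_on {0..1}"
      using a by (auto simp: sq_int_def intro: integrable_on_mult_right)
    show "norm ((cmod (a x * w x))\<^sup>2) \<le> B\<^sup>2 * (cmod (a x))\<^sup>2" if "x \<in> {0..1}" for x
      using B that 
      by (auto simp: norm_mult power_mult_distrib mult.commute [of "B\<^sup>2"] intro!: mult_left_mono power_mono)
  qed simp
  moreover have "(\<lambda>x. a x * w x) integrable_on {0..1}"
    using sq_int_product [OF a sq_int_continuous [OF w]] by (simp add: absolutely_integrable_on_def)
  ultimately show ?thesis
    by (auto simp: sq_int_def absolutely_integrable_on_def)
qed

lemma has_integral_affine_piece:
  fixes h :: "real \<Rightarrow> 'a::euclidean_space"
  assumes h: "h integrable_on {0..1}" and "j < n"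
  shows "((\<lambda>x. h ((x + real j) / real n)) has_integral
            (real n *\<^sub>R integral {real j / real n..(real j + 1) / real n} h)) {0..1}"
proof -
  have n: "real n > 0" "real j + 1 \<le> real n" using \<open>j < n\<close> by auto
  have "h integrable_on {real j / real n..(real j + 1) / real n}"
    using n by (intro integrable_subinterval_real [OF h]) (auto simp: field_simps)
  then have "(h has_integral (integral {real j / real n..(real j + 1) / real n} h))
      (cbox (real j / real n) ((real j + 1) / real n))"
    by (simp add: has_integral_integral)
  then have "((\<lambda>x. h ((1 / real n) *\<^sub>R x + real j / real n)) has_integral
        (integral {real j / real n..(real j + 1) / real n} h) /\<^sub>R (1 / real n) ^ DIM(real))
        (cbox ((real j / real n - real j / real n) /\<^sub>R (1 / real n))
              (((real j + 1) / real n - real j / real n) /\<^sub>R (1 / real n)))"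
    using n by (intro has_integral_affinity') auto
  also have "(cbox ((real j / real n - real j / real n) /\<^sub>R (1 / real n))
              (((real j + 1) / real n - real j / real n) /\<^sub>R (1 / real n))) = {0..1}"
    using n by (simp add: diff_divide_distrib [symmetric])
  finally show ?thesis
    using n by (simp add: add_divide_distrib)
qed

lemma sum_integral_pieces:
  fixes h :: "real \<Rightarrow> 'a::euclidean_space"
  assumes h: "h integrable_on {0..1}" and "0 < n"
  shows "(\<Sum>j<n. integral {real j / real n..(real j + 1) / real n} h) = integral {0..1} h"
proof -
  have "(\<Sum>j<m. integral {real j / real n..(real j + 1) / real n} h) = integral {0..real m / real n} h"
    if "m \<le> n" for m
    using that
  proof (induction m)
    case (Suc m)
    have "integral {0..real m / real n} h + integral {real m / real n..(real m + 1) / real n} h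
        = integral {0..(real m + 1) / real n} h"
      using Suc.prems
      by (intro Henstock_Kurzweil_Integration.integral_combine integrable_subinterval_real [OF h])
         (auto simp: field_simps)
    with Suc show ?case by (simp add: add.commute)
  qed auto
  from this [of n] show ?thesis using \<open>0 < n\<close> by simp
qed

lemma sq_int_affine:
  assumes "sq_int g" "j < n"
  shows "sq_int (\<lambda>x. g ((x + real j) / real n))"
  using assms has_integral_affine_piece [of g j n]
    has_integral_affine_piece [of "\<lambda>x. (cmod (g x))\<^sup>2" j n]
  unfolding sq_int_def by blast

section \<open>Fourier coefficients and the Fourier series at an end point\<close>

text \<open>The sign is that of the weight $e^{-2\pi i kx}$ in the integral $I_k$, so that \<open>fhat k\<close> below is
  the usual \<open>k\<close>-th Fourier coefficient.\<close>

definition wave :: "int \<Rightarrow> real \<Rightarrow> complex" where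
  "wave k x = exp (- 2 * of_real pi * \<i> * of_int k * of_real x)"

definition fhat :: "int \<Rightarrow> (real \<Rightarrow> complex) \<Rightarrow> complex" where
  "fhat k g = integral {0..1} (\<lambda>x. g x * wave k x)"

lemma wave_has_vector_derivative:
  "(wave k has_vector_derivative (- 2 * of_real pi * \<i> * of_int k) * wave k x) (at x within S)"
  unfolding wave_def
  by (rule has_vector_derivative_real_field) (auto intro!: derivative_eq_intros)

lemma continuous_on_wave [continuous_intros]: "continuous_on S (wave k)"
  unfolding wave_def by (intro continuous_intros)

lemma wave_add: "wave (j + k) x = wave j x * wave k x"
  by (simp add: wave_def algebra_simps flip: exp_add)

lemma wave_zero [simp]: "wave 0 x = 1"
  by (simp add: wave_def)

lemma wave_of_int [simp]: "wave k (of_int m) = 1"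
  unfolding wave_def exp_eq_1 by (auto intro!: exI [of _ "- (k * m)"])

lemma wave_at_0 [simp]: "wave k 0 = 1" and wave_at_1 [simp]: "wave k 1 = 1"
  using wave_of_int [of k 0] wave_of_int [of k 1] by auto

lemma norm_wave [simp]: "cmod (wave k x) = 1"
  by (simp add: wave_def)

lemma cnj_wave: "cnj (wave k x) = wave (- k) x"
  by (simp add: wave_def exp_cnj)

lemma integral_wave: "(wave k has_integral (if k = 0 then 1 else 0)) {0..1}"
proof (cases "k = 0")
  case True
  then have "wave k = (\<lambda>x. 1)" by auto
  then show ?thesis using has_integral_const_real [of "1::complex" 0 1] True by simp
next
  case False
  define c where "c = - 2 * of_real pi * \<i> * of_int k"
  have "((\<lambda>x. c * wave k x) has_integral (wave k 1 - wave k 0)) {0..1}"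
    unfolding c_def by (intro fundamental_theorem_of_calculus wave_has_vector_derivative) simp
  then have "((\<lambda>x. (1/c) * (c * wave k x)) has_integral (1/c) * 0) {0..1}"
    by (intro has_integral_mult_right) simp
  then show ?thesis using False by (simp add: c_def)
qed

lemma sq_int_wave: "sq_int (wave k)"
  by (intro sq_int_continuous continuous_intros)

lemma fhat_has_integral:
  "sq_int g \<Longrightarrow> ((\<lambda>x. g x * wave k x) has_integral fhat k g) {0..1}"
  unfolding fhat_def using sq_int_product [OF _ sq_int_wave]
  by (intro integrable_integral) (simp add: absolutely_integrable_on_def)

lemma fourier_integral_eq_fhat:
  assumes "sq_int f"
  shows "fourier_integral k f = fhat k f"
proof -
  have "integrable (lebesgue_on {0..1}) (\<lambda>x. f x * wave k x)"
    using sq_int_product [OF assms sq_int_wave] by (simp add: integrable_restrict_space set_integrable_def)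
  then show ?thesis
    unfolding fourier_integral_def fhat_def wave_def by (rule lebesgue_integral_eq_integral) simp
qed

text \<open>Integration by parts; the boundary terms cancel by periodicity.\<close>

lemma fhat_deriv:
  assumes F: "ac_deriv F F'" "F 0 = F 1" and F': "sq_int F'"
  shows "fhat h F' = (2 * of_real pi * \<i> * of_int h) * fhat h F"
proof -
  define c where "c = - 2 * of_real pi * \<i> * of_int h"
  have "ac_deriv (\<lambda>x. F x * wave h x) (\<lambda>x. F x * (c * wave h x) + F' x * wave h x)"
    unfolding c_def by (intro ac_deriv_mult F wave_has_vector_derivative continuous_intros)
  from ac_deriv_has_integral [OF this]
  have "((\<lambda>x. c * (F x * wave h x) + F' x * wave h x) has_integral 0) {0..1}"
    using F(2) by (simp add: mult_ac)
  moreover have "((\<lambda>x. c * (F x * wave h x) + F' x * wave h x) has_integral (c * fhat h F + fhat h F')) {0..1}"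
    by (intro has_integral_add has_integral_mult_right fhat_has_integral F' sq_int_continuous
        ac_deriv_continuous_on [OF F(1)])
  ultimately have "c * fhat h F + fhat h F' = 0"
    using has_integral_unique by blast
  then show ?thesis by (simp add: c_def add_eq_0_iff)
qed

text \<open>This is the expansion of $\|g-T\|^2$ for a trigonometric polynomial $T$, in which
  orthonormality of the exponentials leaves only the diagonal of $\|T\|^2$. The frequencies are given by
  an injection \<open>m\<close> because the error of the quadrature involves only the frequencies in one residue
  class.\<close>

lemma l2norm_diff_trig_poly_squared:
  fixes m :: "'b \<Rightarrow> int"
  assumes g: "continuous_on {0..1} g" and J: "finite J" "inj_on m J"
  shows "(l2norm (\<lambda>x. g x - (\<Sum>h\<in>J. c h * wave (m h) x)))\<^sup>2
         = (l2norm g)\<^sup>2 - 2 * Re (\<Sum>h\<in>J. cnj (c h) * fhat (- m h) g) + (\<Sum>h\<in>J. (cmod (c h))\<^sup>2)"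
proof -
  define T where "T = (\<lambda>x. \<Sum>h\<in>J. c h * wave (m h) x)"
  define G where "G = complex_of_real ((l2norm g)\<^sup>2)"
  define S where "S = (\<Sum>h\<in>J. cnj (c h) * fhat (- m h) g)"
  have T: "continuous_on {0..1} T" unfolding T_def by (intro continuous_intros)
  have I1: "((\<lambda>x. of_real ((cmod (g x))\<^sup>2)) has_integral G) {0..1}"
    using sq_int_continuous [OF g] l2norm_squared [OF sq_int_continuous [OF g]] unfolding G_def
    by (intro has_integral_of_real) (simp add: sq_int_def integrable_integral)
  have I2: "((\<lambda>x. \<Sum>h\<in>J. cnj (c h) * (g x * wave (- m h) x)) has_integral S) {0..1}"
    unfolding S_def using g
    by (intro has_integral_sum J has_integral_mult_right fhat_has_integral sq_int_continuous)
  have I3: "((\<lambda>x. \<Sum>h\<in>J. \<Sum>l\<in>J. (c h * cnj (c l)) * wave (m h - m l) x) has_integral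
        (\<Sum>h\<in>J. \<Sum>l\<in>J. (c h * cnj (c l)) * (if m h - m l = 0 then 1 else 0))) {0..1}"
    by (intro has_integral_sum J has_integral_mult_right integral_wave)
  have diag: "(\<Sum>h\<in>J. \<Sum>l\<in>J. (c h * cnj (c l)) * (if m h - m l = 0 then 1 else 0))
      = (\<Sum>h\<in>J. of_real ((cmod (c h))\<^sup>2))"
  proof (intro sum.cong refl)
    fix h assume "h \<in> J"
    then have "(\<Sum>l\<in>J. (c h * cnj (c l)) * (if m h - m l = 0 then 1 else 0))
        = (\<Sum>l\<in>J. if h = l then c h * cnj (c l) else 0)"
      using J(2) by (intro sum.cong) (auto simp: inj_on_def)
    also have "\<dots> = c h * cnj (c h)" using J(1) \<open>h \<in> J\<close> by simp
    finally show "(\<Sum>l\<in>J. (c h * cnj (c l)) * (if m h - m l = 0 then 1 else 0)) = of_real ((cmod (c h))\<^sup>2)"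
      by (simp only: complex_norm_square)
  qed
  have "of_real ((cmod (g x - T x))\<^sup>2) = of_real ((cmod (g x))\<^sup>2)
      - (\<Sum>h\<in>J. cnj (c h) * (g x * wave (- m h) x))
      - cnj (\<Sum>h\<in>J. cnj (c h) * (g x * wave (- m h) x))
      + (\<Sum>h\<in>J. \<Sum>l\<in>J. (c h * cnj (c l)) * wave (m h - m l) x)" for x
  proof -
    have gT: "(\<Sum>h\<in>J. cnj (c h) * (g x * wave (- m h) x)) = g x * cnj (T x)"
      by (simp add: T_def cnj_wave sum_distrib_left mult_ac)
    have TT: "(\<Sum>h\<in>J. \<Sum>l\<in>J. (c h * cnj (c l)) * wave (m h - m l) x) = T x * cnj (T x)"
      by (simp add: T_def cnj_wave sum_product diff_conv_add_uminus wave_add mult_ac del: add_uminus_conv_diff)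
    show ?thesis unfolding gT TT
      by (simp only: complex_norm_square) (simp add: algebra_simps)
  qed
  moreover have "((\<lambda>x. of_real ((cmod (g x))\<^sup>2)
      - (\<Sum>h\<in>J. cnj (c h) * (g x * wave (- m h) x))
      - (cnj \<circ> (\<lambda>x. \<Sum>h\<in>J. cnj (c h) * (g x * wave (- m h) x))) x
      + (\<Sum>h\<in>J. \<Sum>l\<in>J. (c h * cnj (c l)) * wave (m h - m l) x)) has_integral
      G - S - cnj S + (\<Sum>h\<in>J. of_real ((cmod (c h))\<^sup>2))) {0..1}"
    using I1 I2 I3 unfolding diag
    
    by (intro has_integral_add has_integral_diff) (simp_all only: has_integral_cnj)
  ultimately have "((\<lambda>x. complex_of_real ((cmod (g x - T x))\<^sup>2)) has_integral
      G - S - cnj S + (\<Sum>h\<in>J. of_real ((cmod (c h))\<^sup>2))) {0..1}"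
    by (simp only: o_def)
  from has_integral_Re [OF this] have "((\<lambda>x. (cmod (g x - T x))\<^sup>2) has_integral
      Re (G - S - cnj S + (\<Sum>h\<in>J. of_real ((cmod (c h))\<^sup>2)))) {0..1}"
    by (simp only: Re_complex_of_real)
  moreover have "Re (G - S - cnj S + (\<Sum>h\<in>J. of_real ((cmod (c h))\<^sup>2)))
      = (l2norm g)\<^sup>2 - 2 * Re S + (\<Sum>h\<in>J. (cmod (c h))\<^sup>2)"
    by (simp add: G_def)
  moreover have "sq_int (\<lambda>x. g x - T x)"
    by (intro sq_int_continuous continuous_intros g T)
  ultimately show ?thesis
    unfolding S_def T_def by (simp add: l2norm_squared integral_unique)
qed

lemma l2norm_trig_poly:
  fixes m :: "'b \<Rightarrow> int"
  assumes J: "finite J" "inj_on m J"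
  shows "l2norm (\<lambda>x. \<Sum>h\<in>J. c h * wave (m h) x) = sqrt (\<Sum>h\<in>J. (cmod (c h))\<^sup>2)"
proof -
  have "(l2norm (\<lambda>x. \<Sum>h\<in>J. c h * wave (m h) x))\<^sup>2 = (\<Sum>h\<in>J. (cmod (c h))\<^sup>2)"
    using l2norm_diff_trig_poly_squared [of "\<lambda>x. 0", OF _ J, of "\<lambda>h. - c h"]
    by (simp add: sum_negf l2norm_def fhat_def)
  then show ?thesis using l2norm_nonneg by (metis real_sqrt_unique)
qed

text \<open>Frequency \<open>0\<close> is left out because the sawtooth has mean zero, and because in the aliasing sum
  it belongs to the exact value of the integral.\<close>

definition punctured :: "nat \<Rightarrow> int set" where
  "punctured N = {- int N..int N} - {0}"

lemma finite_punctured [simp]: "finite (punctured N)"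
  by (simp add: punctured_def)

lemma sum_punctured:
  fixes q :: "int \<Rightarrow> 'a::comm_monoid_add"
  shows "(\<Sum>h\<in>punctured N. q h) = (\<Sum>j<N. q (int j + 1) + q (- (int j + 1)))"
proof (induction N)
  case 0
  show ?case by (simp add: punctured_def)
next
  case (Suc N)
  have "punctured (Suc N) = insert (int N + 1) (insert (- (int N + 1)) (punctured N))"
    by (auto simp: punctured_def)
  moreover have "int N + 1 \<notin> insert (- (int N + 1)) (punctured N)" "- (int N + 1) \<notin> punctured N"
    by (auto simp: punctured_def)
  ultimately show ?case using Suc by (simp add: add_ac)
qed

text \<open>The Fourier coefficients of the sawtooth $b(x)=x-\frac12$ have modulus $1/(2\pi|h|)$, so the
  squared distance of $b$ from its $N$-th partial sum is
  $\|b\|^2-\sum_{0<|h|\le N}(2\pi h)^{-2}$. With $\|b\|^2=\frac1{12}$, Basel's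
  $\sum_{h\ge1} h^{-2}=\pi^2/6$ says exactly that this tends to \<open>0\<close>.\<close>

lemma sawtooth_fourier_L2:
  "(\<lambda>N. l2norm (\<lambda>x. (of_real x - 1/2) - (\<Sum>h\<in>punctured N. 1 / (2 * of_real pi * \<i> * of_int h) * wave h x)))
     \<longlonglongrightarrow> 0"
proof -
  define b where "b = (\<lambda>x. complex_of_real x - 1/2)"
  have bc: "continuous_on {0..1} b" unfolding b_def by (intro continuous_intros)
  have bd: "(b has_vector_derivative 1) (at x within {0..1})" for x
    unfolding b_def by (auto intro!: derivative_eq_intros)
  have coeff: "fhat (- h) b = 1 / (2 * of_real pi * \<i> * of_int h)" if "h \<noteq> 0" for h
  proof -
    define c where "c = 2 * of_real pi * \<i> * of_int h"
    have "ac_deriv (\<lambda>x. b x * wave (- h) x) (\<lambda>x. b x * (c * wave (- h) x) + 1 * wave (- h) x)"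
      using wave_has_vector_derivative [of "- h"] unfolding c_def
      by (intro ac_deriv_mult ac_deriv_continuously_differentiable bd continuous_intros) simp_all
    from ac_deriv_has_integral [OF this]
    have "((\<lambda>x. c * (b x * wave (- h) x) + wave (- h) x) has_integral 1) {0..1}"
      by (simp add: b_def mult_ac)
    moreover have "((\<lambda>x. c * (b x * wave (- h) x) + wave (- h) x) has_integral (c * fhat (- h) b + 0)) {0..1}"
      using integral_wave [of "- h"] \<open>h \<noteq> 0\<close>
      by (intro has_integral_add has_integral_mult_right fhat_has_integral sq_int_continuous bc) simp
    ultimately have "c * fhat (- h) b + 0 = 1"
      using has_integral_unique by blast
    then show ?thesis using that by (simp add: c_def field_simps)
  qed
  have norm_b: "(l2norm b)\<^sup>2 = 1/12"
  proof -
    have "((\<lambda>x. (x - 1/2)\<^sup>2) has_integral ((1 - 1/2)^3/3 - (0 - 1/2)^3/3)) {0..1::real}"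
      by (intro fundamental_theorem_of_calculus)
         (auto intro!: derivative_eq_intros simp flip: has_real_derivative_iff_has_vector_derivative
               simp: power2_eq_square)
    moreover have "(cmod (b x))\<^sup>2 = (x - 1/2)\<^sup>2" for x
    proof -
      have "b x = of_real (x - 1/2)" by (simp add: b_def)
      then show ?thesis by (simp only: norm_of_real power2_abs)
    qed
    ultimately show ?thesis
      by (simp add: l2norm_squared [OF sq_int_continuous [OF bc]] integral_unique power3_eq_cube)
  qed
  have sq: "(l2norm (\<lambda>x. b x - (\<Sum>h\<in>punctured N. 1 / (2 * of_real pi * \<i> * of_int h) * wave h x)))\<^sup>2
      = 1/12 - 1 / (2 * pi\<^sup>2) * (\<Sum>j<N. 1 / (real j + 1)\<^sup>2)" (is "(?l N)\<^sup>2 = _") for N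
  proof -
    define c where "c = (\<lambda>h::int. 1 / (2 * of_real pi * \<i> * of_int h))"
    have "(\<Sum>h\<in>punctured N. cnj (c h) * fhat (- h) b) = (\<Sum>h\<in>punctured N. of_real ((cmod (c h))\<^sup>2))"
    proof (intro sum.cong refl)
      fix h assume "h \<in> punctured N"
      then have "fhat (- h) b = c h" by (simp add: coeff c_def punctured_def)
      then show "cnj (c h) * fhat (- h) b = of_real ((cmod (c h))\<^sup>2)"
        by (simp only: complex_norm_square mult.commute)
    qed
    then have "(?l N)\<^sup>2 = 1/12 - (\<Sum>h\<in>punctured N. (cmod (c h))\<^sup>2)"
      using l2norm_diff_trig_poly_squared [OF bc finite_punctured, of "\<lambda>h. h" N c]
      by (simp add: c_def norm_b del: of_real_power)
    also have "(\<Sum>h\<in>punctured N. (cmod (c h))\<^sup>2) = (\<Sum>j<N. 1 / (2 * pi\<^sup>2) * (1 / (real j + 1)\<^sup>2))"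
      unfolding sum_punctured
    proof (intro sum.cong refl)
      fix j
      have "cmod (of_int (int j + 1)) = real j + 1" "cmod (of_int (- (int j + 1))) = real j + 1"
        by (simp_all only: norm_of_int)
      then show "(cmod (c (int j + 1)))\<^sup>2 + (cmod (c (- (int j + 1))))\<^sup>2 = 1 / (2 * pi\<^sup>2) * (1 / (real j + 1)\<^sup>2)"
        unfolding c_def norm_divide norm_mult by (simp add: power_mult_distrib power_divide)
    qed
    finally show ?thesis by (simp add: sum_distrib_left)
  qed
  have "(\<lambda>N. \<Sum>j<N. 1 / (real j + 1)\<^sup>2) \<longlonglongrightarrow> pi\<^sup>2 / 6"
    using inverse_squares_sums by (simp add: sums_def add.commute)
  then have "(\<lambda>N. (?l N)\<^sup>2) \<longlonglongrightarrow> 1/12 - 1 / (2 * pi\<^sup>2) * (pi\<^sup>2 / 6)"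
    unfolding sq by (intro tendsto_intros)
  then have "(\<lambda>N. sqrt ((?l N)\<^sup>2)) \<longlonglongrightarrow> sqrt 0"
    by (intro tendsto_real_sqrt) simp
  then show ?thesis by (simp add: l2norm_nonneg b_def)
qed

text \<open>Integration by parts against the sawtooth gives $F(0)-\hat F(0)=\int_0^1 (x-\frac12)F'(x)\,dx$;
  replacing the sawtooth by the partial sum of its Fourier series gives the partial sum of the nonzero
  Fourier coefficients of $F$. By Cauchy--Schwarz the difference is at most $\|F'\|$ times the
  $L_2$-distance of the sawtooth from its partial sum.\<close>

lemma fourier_series_at_endpoint:
  assumes F: "ac_deriv F F'" "F 0 = F 1" and F': "sq_int F'"
  shows "(\<lambda>N. \<Sum>h\<in>punctured N. fhat h F) \<longlonglongrightarrow> F 0 - fhat 0 F"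
proof -
  define R where "R = (\<lambda>N x. (of_real x - 1/2) - (\<Sum>h\<in>punctured N. 1 / (2 * of_real pi * \<i> * of_int h) * wave h x))"
  have Rc: "continuous_on {0..1} (R N)" for N unfolding R_def by (intro continuous_intros)
  have "F 0 - fhat 0 F - (\<Sum>h\<in>punctured N. fhat h F) = integral {0..1} (\<lambda>x. F' x * R N x)" for N
  proof -
    have "ac_deriv (\<lambda>x. F x * (of_real x - 1/2)) (\<lambda>x. F x * 1 + F' x * (of_real x - 1/2))"
      by (intro ac_deriv_mult F) (auto intro!: derivative_eq_intros)
    from ac_deriv_has_integral [OF this]
    have "((\<lambda>x. F x + F' x * (of_real x - 1/2)) has_integral F 0) {0..1}"
      using F(2) by (simp add: field_simps)
    moreover have "(F has_integral fhat 0 F) {0..1}"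
      using fhat_has_integral [OF sq_int_continuous [OF ac_deriv_continuous_on [OF F(1)]], of 0] by simp
    ultimately have "((\<lambda>x. F x + F' x * (of_real x - 1/2) - F x) has_integral F 0 - fhat 0 F) {0..1}"
      by (rule has_integral_diff)
    then have "((\<lambda>x. F' x * (of_real x - 1/2)) has_integral F 0 - fhat 0 F) {0..1}" by simp
    moreover have "((\<lambda>x. \<Sum>h\<in>punctured N. 1 / (2 * of_real pi * \<i> * of_int h) * (F' x * wave h x)) has_integral
        (\<Sum>h\<in>punctured N. fhat h F)) {0..1}"
    proof -
      have "(\<Sum>h\<in>punctured N. 1 / (2 * of_real pi * \<i> * of_int h) * fhat h F')
          = (\<Sum>h\<in>punctured N. fhat h F)"
        using fhat_deriv [OF F F'] by (intro sum.cong) (auto simp: punctured_def)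
      moreover have "((\<lambda>x. \<Sum>h\<in>punctured N. 1 / (2 * of_real pi * \<i> * of_int h) * (F' x * wave h x)) has_integral
          (\<Sum>h\<in>punctured N. 1 / (2 * of_real pi * \<i> * of_int h) * fhat h F')) {0..1}"
        by (intro has_integral_sum has_integral_mult_right fhat_has_integral F') simp
      ultimately show ?thesis by (simp only:)
    qed
    ultimately have "((\<lambda>x. F' x * (of_real x - 1/2) -
          (\<Sum>h\<in>punctured N. 1 / (2 * of_real pi * \<i> * of_int h) * (F' x * wave h x)))
        has_integral F 0 - fhat 0 F - (\<Sum>h\<in>punctured N. fhat h F)) {0..1}"
      by (rule has_integral_diff)
    moreover have "F' x * R N x = F' x * (of_real x - 1/2) -
          (\<Sum>h\<in>punctured N. 1 / (2 * of_real pi * \<i> * of_int h) * (F' x * wave h x))" for x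
      unfolding R_def right_diff_distrib [of "F' x"] sum_distrib_left by (simp add: mult_ac)
    ultimately show ?thesis by (simp add: integral_unique)
  qed
  then have bound: "cmod (F 0 - fhat 0 F - (\<Sum>h\<in>punctured N. fhat h F)) \<le> l2norm F' * l2norm (R N)" for N
    using Cauchy_Schwarz_sq_int [OF F' sq_int_continuous [OF Rc]] by simp
  have "(\<lambda>N. l2norm F' * l2norm (R N)) \<longlonglongrightarrow> l2norm F' * 0"
    unfolding R_def by (intro tendsto_mult_left sawtooth_fourier_L2)
  then have "(\<lambda>N. F 0 - fhat 0 F - (\<Sum>h\<in>punctured N. fhat h F)) \<longlonglongrightarrow> 0"
    using Lim_null_comparison [OF always_eventually [OF allI [OF bound]]] by simp
  then have "(\<lambda>N. (F 0 - fhat 0 F) - (F 0 - fhat 0 F - (\<Sum>h\<in>punctured N. fhat h F))) \<longlonglongrightarrow> (F 0 - fhat 0 F) - 0"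
    by (intro tendsto_diff tendsto_const)
  then show ?thesis by simp
qed

section \<open>Periodic Sobolev functions\<close>

lemma nderiv_0 [simp]: "nderiv 0 f = f"
  by (simp add: nderiv_def)

lemma nderiv_Suc: "nderiv (Suc l) f x = vector_derivative (nderiv l f) (at x within {0..1})"
  by (simp add: nderiv_def)

text \<open>Below the top order, \<open>nderiv (Suc l) f\<close> is continuous (it is differentiable, or it is the absolutely
  continuous derivative of order \<open>s - 1\<close>), so \<open>nderiv l f\<close> is continuously differentiable. Only at
  \<open>l = s - 1\<close> does the derivative exist merely almost everywhere.\<close>

lemma sobolev_ac_deriv:
  assumes f: "f \<in> sobolev s" and l: "l < s"
  shows "ac_deriv (nderiv l f) (nderiv (Suc l) f)"
proof -
  have dif: "\<And>l x. Suc l < s \<Longrightarrow> x \<in> {0..1} \<Longrightarrow> nderiv l f differentiable (at x within {0..1})"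
    and AC: "abs_continuous_on_interval 0 1 (nderiv (s - 1) f)"
    and AE: "AE x in lebesgue_on {0..1}. nderiv (s - 1) f differentiable (at x within {0..1})"
    using f by (auto simp: sobolev_def)
  have vd: "(nderiv l f has_vector_derivative nderiv (Suc l) f x) (at x within {0..1})"
    if "nderiv l f differentiable (at x within {0..1})" for l x
    using that by (simp add: nderiv_Suc vector_derivative_works)
  show ?thesis
  proof (cases "Suc l = s")
    case True
    then have "AE x in lebesgue_on {0..1}. nderiv l f differentiable (at x within {0..1})"
      using AE by auto
    then have "AE x in lebesgue. x \<in> {0..1} \<longrightarrow> nderiv l f differentiable (at x within {0..1})"
      by (subst (asm) AE_restrict_space_iff) auto
    then obtain N where "N \<in> null_sets lebesgue"
        "{x. \<not> (x \<in> {0..1} \<longrightarrow> nderiv l f differentiable (at x within {0..1}))} \<subseteq> N"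
      unfolding eventually_ae_filter by auto
    then show ?thesis
      using vd AC True unfolding ac_deriv_def by (auto simp: negligible_iff_null_sets intro!: exI [of _ N])
  next
    case False
    then have "Suc l < s" using l by simp
    have "continuous_on {0..1} (nderiv (Suc l) f)"
    proof (cases "Suc (Suc l) = s")
      case True
      then have "s - 1 = Suc l" by simp
      then show ?thesis using abs_continuous_imp_continuous_on [OF AC] by simp
    next
      case False
      then have "Suc (Suc l) < s" using \<open>Suc l < s\<close> by simp
      then show ?thesis
        using dif by (auto simp: continuous_on_eq_continuous_within intro!: differentiable_imp_continuous_within)
    qed
    then show ?thesis
      using vd dif [OF \<open>Suc l < s\<close>] by (intro ac_deriv_continuously_differentiable) auto
  qed
qed

lemma sobolev_sq_int:
  assumes f: "f \<in> sobolev s" and l: "l \<le> s"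
  shows "sq_int (nderiv l f)"
proof (cases "l = s")
  case True
  then show ?thesis using f by (simp add: sobolev_def square_integrable01_imp_sq_int)
next
  case False
  then show ?thesis
    using sobolev_ac_deriv [OF f, of l] l by (intro sq_int_continuous ac_deriv_continuous_on) auto
qed

lemma fhat_nderiv:
  assumes f: "f \<in> periodic_sobolev s" and l: "l \<le> s"
  shows "fhat h (nderiv l f) = (2 * of_real pi * \<i> * of_int h) ^ l * fhat h f"
  using l
proof (induction l)
  case (Suc l)
  have "fhat h (nderiv (Suc l) f) = (2 * of_real pi * \<i> * of_int h) * fhat h (nderiv l f)"
    using f Suc.prems
    by (intro fhat_deriv sobolev_ac_deriv sobolev_sq_int) (auto simp: periodic_sobolev_def)
  with Suc show ?case by simp
qed simp

lemma integrable_sq_int: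
  assumes "sq_int g"
  shows "integrable (lebesgue_on {0..1}) (\<lambda>x. (cmod (g x))\<^sup>2)"
proof -
  have "(\<lambda>x. (cmod (g x))\<^sup>2) absolutely_integrable_on {0..1}"
    using assms by (intro nonnegative_absolutely_integrable_1) (auto simp: sq_int_def)
  then show ?thesis by (simp add: integrable_restrict_space set_integrable_def)
qed

text \<open>The inner product is complex-valued by type; this exhibits the norm as a sum of squares, from which
  the bound on the top derivative can be read off.\<close>

lemma sobolev_norm_eq:
  assumes "sq_int (nderiv s f)"
  shows "sobolev_norm s f =
     sqrt ((\<Sum>l<s. (cmod (LINT x|lebesgue_on {0..1}. nderiv l f x))\<^sup>2) + (l2norm (nderiv s f))\<^sup>2)"
proof -
  have "(LINT x|lebesgue_on {0..1}. nderiv s f x * cnj (nderiv s f x))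
      = complex_of_real (LINT x|lebesgue_on {0..1}. (cmod (nderiv s f x))\<^sup>2)"
    by (simp only: complex_norm_square [symmetric] integral_complex_of_real)
  also have "(LINT x|lebesgue_on {0..1}. (cmod (nderiv s f x))\<^sup>2) = (l2norm (nderiv s f))\<^sup>2"
    unfolding l2norm_squared [OF assms]
    by (intro lebesgue_integral_eq_integral integrable_sq_int assms) simp
  finally have top: "(LINT x|lebesgue_on {0..1}. nderiv s f x * cnj (nderiv s f x))
      = complex_of_real ((l2norm (nderiv s f))\<^sup>2)" .
  have low: "(LINT x|lebesgue_on {0..1}. nderiv l f x) * (LINT x|lebesgue_on {0..1}. cnj (nderiv l f x))
      = complex_of_real ((cmod (LINT x|lebesgue_on {0..1}. nderiv l f x))\<^sup>2)" for l
    unfolding Bochner_Integration.integral_cnj complex_norm_square ..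
  have "sobolev_inner s f f = complex_of_real
     ((\<Sum>l<s. (cmod (LINT x|lebesgue_on {0..1}. nderiv l f x))\<^sup>2) + (l2norm (nderiv s f))\<^sup>2)"
    unfolding sobolev_inner_def top low by simp
  then show ?thesis
    unfolding sobolev_norm_def by (simp only: Re_complex_of_real)
qed

lemma l2norm_nderiv_le:
  assumes "f \<in> sobolev s" "sobolev_norm s f \<le> 1"
  shows "l2norm (nderiv s f) \<le> 1"
proof -
  have "(\<Sum>l<s. (cmod (LINT x|lebesgue_on {0..1}. nderiv l f x))\<^sup>2) + (l2norm (nderiv s f))\<^sup>2 \<le> 1"
    using assms(2) by (simp add: sobolev_norm_eq [OF sobolev_sq_int [OF assms(1) order_refl]])
  moreover have "0 \<le> (\<Sum>l<s. (cmod (LINT x|lebesgue_on {0..1}. nderiv l f x))\<^sup>2)"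
    by (simp add: sum_nonneg)
  ultimately have "(l2norm (nderiv s f))\<^sup>2 \<le> 1" by linarith
  then show ?thesis using l2norm_nonneg [of "nderiv s f"] by (simp add: power2_le_iff_abs_le abs_square_le_1)
qed

lemma l2norm_wave [simp]: "l2norm (wave k) = 1"
  by (simp add: l2norm_def)

lemma cmod_fourier_factor: "cmod (2 * of_real pi * \<i> * of_int h) = 2 * pi * real_of_int \<bar>h\<bar>"
  by (simp add: norm_mult)

lemma fhat_le:
  assumes f: "f \<in> periodic_sobolev s" and k: "k \<noteq> 0"
  shows "cmod (fhat k f) \<le> l2norm (nderiv s f) / (2 * pi * real_of_int \<bar>k\<bar>) ^ s"
proof -
  have "(2 * pi * real_of_int \<bar>k\<bar>) ^ s * cmod (fhat k f) = cmod (fhat k (nderiv s f))"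
    unfolding fhat_nderiv [OF f order_refl] norm_mult [of "_ ^ _"] norm_power cmod_fourier_factor ..
  also have "\<dots> \<le> l2norm (nderiv s f)"
    using Cauchy_Schwarz_sq_int [OF sobolev_sq_int [of f s] sq_int_wave [of k]] f
    by (simp add: fhat_def periodic_sobolev_def)
  finally show ?thesis using k by (simp add: pos_le_divide_eq mult.commute)
qed

text \<open>The formula holds only on \<open>{0..1}\<close>: outside, the filter of the derivative is trivial and
  \<^const>\<open>vector_derivative\<close> is an arbitrary value.\<close>

lemma nderiv_scaled_wave:
  assumes "x \<in> {0..1}"
  shows "nderiv l (\<lambda>x. a * wave (- k) x) x = (2 * of_real pi * \<i> * of_int k) ^ l * a * wave (- k) x"
  using assms
proof (induction l arbitrary: x)
  case (Suc l)
  define c where "c = 2 * of_real pi * \<i> * of_int k"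
  have "((\<lambda>x. c ^ l * a * wave (- k) x) has_vector_derivative c ^ l * a * (c * wave (- k) x)) (at x within {0..1})"
    using wave_has_vector_derivative [of "- k"] unfolding c_def
    by (intro has_vector_derivative_mult_right) simp
  then have "(nderiv l (\<lambda>x. a * wave (- k) x) has_vector_derivative c ^ l * a * (c * wave (- k) x)) (at x within {0..1})"
    using Suc unfolding c_def by (auto intro: has_vector_derivative_transform [rotated 2])
  then have "nderiv (Suc l) (\<lambda>x. a * wave (- k) x) x = c ^ l * a * (c * wave (- k) x)"
    unfolding nderiv_Suc using Suc.prems by (intro vector_derivative_within_closed_interval) simp_all
  then show ?case by (simp add: c_def mult_ac)
qed simp

lemma scaled_wave_periodic_sobolev:
  assumes s: "s \<ge> 1" 
  shows "(\<lambda>x. a * wave (- k) x) \<in> periodic_sobolev s"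
proof -
  define c where "c = 2 * of_real pi * \<i> * of_int k"
  define f where "f = (\<lambda>x. a * wave (- k) x)"
  have nd: "nderiv l f x = c ^ l * a * wave (- k) x" if "x \<in> {0..1}" for l x
    unfolding f_def c_def using nderiv_scaled_wave [OF that] .
  have wd: "((\<lambda>x. c ^ l * a * wave (- k) x) has_vector_derivative c ^ l * a * (c * wave (- k) x)) (at x within {0..1})" for l x
    using wave_has_vector_derivative [of "- k"] unfolding c_def
    by (intro has_vector_derivative_mult_right) simp
  have der: "(nderiv l f has_vector_derivative c ^ l * a * (c * wave (- k) x)) (at x within {0..1})"
    if "x \<in> {0..1}" for l x
    by (rule has_vector_derivative_transform [OF that _ wd]) (rule nd)
  then have dif: "nderiv l f differentiable (at x within {0..1})" if "x \<in> {0..1}" for l x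
    using that by (metis differentiableI_vector)
  have "ac_deriv (nderiv l f) (\<lambda>x. c ^ l * a * (c * wave (- k) x))" for l
    by (intro ac_deriv_continuously_differentiable der continuous_intros) 
  then have "abs_continuous_on_interval 0 1 (nderiv (s - 1) f)"
    by (simp add: ac_deriv_def)
  moreover have "square_integrable01 (nderiv s f)"
  proof -
    have "continuous_on {0..1} (nderiv s f)"
      using dif by (auto simp: continuous_on_eq_continuous_within intro!: differentiable_imp_continuous_within)
    then have "sq_int (nderiv s f)" by (rule sq_int_continuous)
    then show ?thesis unfolding square_integrable01_def
      using sq_int_measurable integrable_sq_int by blast
  qed
  moreover have "AE x in lebesgue_on {0..1}. nderiv (s - 1) f differentiable (at x within {0..1})"
    by (rule AE_I2) (use dif in simp)
  ultimately show ?thesis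
    using dif nd unfolding periodic_sobolev_def sobolev_def f_def by auto
qed

text \<open>The function oscillates with frequency \<open>k\<close>, so all the means in the norm vanish and its top derivative
  has modulus \<open>1\<close> everywhere.\<close>

lemma initial_error_attained:
  assumes s: "s \<ge> 1" and k: "k \<noteq> 0"
  defines "f \<equiv> \<lambda>x. of_real (1 / (2 * pi * real_of_int \<bar>k\<bar>) ^ s) * wave (- k) x"
  shows "sobolev_norm s f = 1" and "fhat k f = of_real (1 / (2 * pi * real_of_int \<bar>k\<bar>) ^ s)"
proof -
  define M where "M = (2 * pi * real_of_int \<bar>k\<bar>) ^ s"
  define c where "c = 2 * of_real pi * \<i> * of_int k"
  have M: "M > 0" using k by (simp add: M_def)
  have f: "f = (\<lambda>x. of_real (1 / M) * wave (- k) x)" by (simp add: f_def M_def)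
  have nd: "nderiv l f x = c ^ l * of_real (1 / M) * wave (- k) x" if "x \<in> {0..1}" for l x
    unfolding f c_def using nderiv_scaled_wave [OF that] .
  have per: "f \<in> periodic_sobolev s" unfolding f by (rule scaled_wave_periodic_sobolev [OF s])
  then have sob: "f \<in> sobolev s" by (simp add: periodic_sobolev_def)
  have mean: "(LINT x|lebesgue_on {0..1}. nderiv l f x) = 0" if "l < s" for l
  proof -
    have "continuous_on {0..1} (nderiv l f)"
      using sobolev_ac_deriv [OF sob that] by (rule ac_deriv_continuous_on)
    then have "integrable (lebesgue_on {0..1}) (nderiv l f)"
      by (rule continuous_imp_integrable_real)
    then have "(LINT x|lebesgue_on {0..1}. nderiv l f x) = integral {0..1} (nderiv l f)"
      by (rule lebesgue_integral_eq_integral) simp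
    also have "\<dots> = integral {0..1} (\<lambda>x. c ^ l * of_real (1 / M) * wave (- k) x)"
      by (intro integral_cong nd)
    also have "\<dots> = c ^ l * of_real (1 / M) * 0"
      using k integral_wave [of "- k"] by (intro integral_unique has_integral_mult_right) simp
    finally show ?thesis by simp
  qed
  have "cmod (nderiv s f x) = 1" if "x \<in> {0..1}" for x
  proof -
    have "cmod (nderiv s f x) = cmod c ^ s * (1 / M)"
      using M by (simp add: nd [OF that] norm_mult norm_power norm_divide)
    then show ?thesis using k unfolding c_def cmod_fourier_factor M_def by simp
  qed
  then have "integral {0..1} (\<lambda>x. (cmod (nderiv s f x))\<^sup>2) = integral {0..1} (\<lambda>x::real. 1::real)"
    by (intro integral_cong) simp
  then have "l2norm (nderiv s f) = 1" by (simp add: l2norm_def)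
  then show "sobolev_norm s f = 1"
    using mean by (simp add: sobolev_norm_eq [OF sobolev_sq_int [OF sob order_refl]])
  have "f x * wave k x = of_real (1 / M) * wave 0 x" for x
    using wave_add [of "- k" k x] by (simp add: f)
  then show "fhat k f = of_real (1 / (2 * pi * real_of_int \<bar>k\<bar>) ^ s)"
    by (simp add: fhat_def M_def)
qed

section \<open>Equispaced quadrature and the information complexity\<close>

text \<open>Put $g(x)=f(x)e^{-2\pi ikx}$ and average it over the \<open>n\<close> cells,
  $F(x)=\frac1n\sum_{j<n}g((x+j)/n)$. Then $F(0)$ is the value of the rectangle rule, and the $h$-th Fourier
  coefficient of $F$ is the $(hn)$-th one of $g$, that is, the $(k+hn)$-th one of $f$. The Fourier series of
  $F$ at \<open>0\<close> therefore expresses the quadrature error through the frequencies that the nodes cannot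
  distinguish from \<open>k\<close>.\<close>

lemma quadrature_aliasing:
  assumes s: "s \<ge> 1" and f: "f \<in> periodic_sobolev s" and n: "n > 0"
  shows "(\<lambda>N. \<Sum>h\<in>punctured N. fhat (k + h * int n) f) \<longlonglongrightarrow>
     (\<Sum>j<n. (1 / of_nat n * wave k (real j / real n)) * f (real j / real n)) - fhat k f"
proof -
  have sob: "f \<in> sobolev s" using f by (simp add: periodic_sobolev_def)
  define f' where "f' = nderiv (Suc 0) f"
  have ff': "ac_deriv f f'" using sobolev_ac_deriv [OF sob, of 0] s by (simp add: f'_def)
  have f'2: "sq_int f'" using sobolev_sq_int [OF sob, of "Suc 0"] s by (simp add: f'_def)
  have f01: "f 0 = f 1" using f s unfolding periodic_sobolev_def by (auto dest: spec [of _ 0])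
  have fc: "continuous_on {0..1} f" using ff' by (rule ac_deriv_continuous_on)
  define c where "c = - 2 * of_real pi * \<i> * of_int k"
  define g where "g = (\<lambda>x. f x * wave k x)"
  define g' where "g' = (\<lambda>x. f x * (c * wave k x) + f' x * wave k x)"
  have gg': "ac_deriv g g'"
    unfolding g_def g'_def c_def by (intro ac_deriv_mult ff' wave_has_vector_derivative continuous_intros)
  have g'2: "sq_int g'"
    unfolding g'_def by (intro sq_int_add sq_int_mult_continuous f'2 continuous_intros sq_int_continuous [OF fc])
  have g01: "g 1 = g 0" using f01 by (simp add: g_def)
  define F where "F = (\<lambda>x. (\<Sum>j<n. g ((x + real j) / real n)) * (1 / of_nat n))"
  define F' where "F' = (\<lambda>x. (\<Sum>j<n. g ((x + real j) / real n)) * 0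
        + (\<Sum>j<n. g' ((x + real j) / real n) / of_real (real n)) * (1 / of_nat n))"
  have FF': "ac_deriv F F'"
    unfolding F_def F'_def by (intro ac_deriv_mult ac_deriv_sum ac_deriv_affine gg') auto
  have F'2: "sq_int F'"
  proof -
    have "sq_int (\<lambda>x. (\<Sum>j<n. g' ((x + real j) / real n) * (1 / of_real (real n))) * (1 / of_nat n))"
      by (intro sq_int_mult_continuous sq_int_sum sq_int_affine g'2) auto
    then show ?thesis by (simp add: F'_def)
  qed
  have F01: "F 0 = F 1"
  proof -
    have "(\<Sum>j<n. g (real (Suc j) / real n) - g (real j / real n)) = g (real n / real n) - g (real 0 / real n)"
      by (rule sum_lessThan_telescope)
    also have "\<dots> = 0" using n g01 by simp
    finally show ?thesis by (simp add: F_def sum_subtractf)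
  qed
  have FhatF: "fhat h F = fhat (k + h * int n) f" for h
  proof -
    define G where "G = (\<lambda>y. f y * wave (k + h * int n) y)"
    have Gi: "G integrable_on {0..1}"
      using fhat_has_integral [OF sq_int_continuous [OF fc]] unfolding G_def integrable_on_def by blast
    have FG: "(\<lambda>x. F x * wave h x) = (\<lambda>x. (1 / of_nat n) * (\<Sum>j<n. G ((x + real j) / real n)))"
    proof
      fix x
      have "G ((x + real j) / real n) = g ((x + real j) / real n) * wave h x" for j
      proof -
        have "wave (h * int n) ((x + real j) / real n) = wave h (x + real j)"
          using n by (simp add: wave_def mult_ac)
        also have "\<dots> = wave h x * wave h (of_int (int j))"
          by (simp add: wave_def algebra_simps flip: exp_add)
        finally have "wave (h * int n) ((x + real j) / real n) = wave h x"
          by (simp only: wave_of_int mult_1_right)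
        then show ?thesis by (simp add: G_def g_def wave_add mult_ac)
      qed
      then show "F x * wave h x = (1 / of_nat n) * (\<Sum>j<n. G ((x + real j) / real n))"
        by (simp add: F_def sum_distrib_left sum_distrib_right mult_ac)
    qed
    have "((\<lambda>x. (1 / of_nat n) * (\<Sum>j<n. G ((x + real j) / real n))) has_integral
        (1 / of_nat n) * (\<Sum>j<n. real n *\<^sub>R integral {real j / real n..(real j + 1) / real n} G)) {0..1}"
      by (intro has_integral_mult_right has_integral_sum has_integral_affine_piece Gi) auto
    also have "(\<Sum>j<n. real n *\<^sub>R integral {real j / real n..(real j + 1) / real n} G)
        = real n *\<^sub>R integral {0..1} G"
      by (simp only: sum_integral_pieces [OF Gi n] flip: scaleR_sum_right)
    also have "(1 / of_nat n) * \<dots> = integral {0..1} G"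
      using n by (simp add: scaleR_conv_of_real)
    finally have "integral {0..1} (\<lambda>x. F x * wave h x) = integral {0..1} G"
      unfolding FG by (rule integral_unique)
    then show ?thesis by (simp only: fhat_def G_def)
  qed
  have F0: "F 0 = (\<Sum>j<n. (1 / of_nat n * wave k (real j / real n)) * f (real j / real n))"
    by (simp add: F_def g_def sum_distrib_left mult_ac sum_divide_distrib)
  show ?thesis
    using fourier_series_at_endpoint [OF FF' F01 F'2] unfolding FhatF F0 by simp
qed

text \<open>Each aliased coefficient of $f$ is that of $f^{(s)}$ divided by $(2\pi i(k+hn))^s$. A partial
  aliasing sum is thus the integral of $f^{(s)}$ against one trigonometric polynomial, whose norm is the
  square root of the sum bounded by \<open>B\<close>.\<close>

lemma quadrature_error_le:
  assumes s: "s \<ge> 1" and f: "f \<in> periodic_sobolev s" and n: "n > 0"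
    and ne: "\<And>h. h \<noteq> 0 \<Longrightarrow> k + h * int n \<noteq> 0"
    and B: "\<And>N. (\<Sum>h\<in>punctured N. (1 / (2 * pi * real_of_int \<bar>k + h * int n\<bar>) ^ s)\<^sup>2) \<le> B\<^sup>2" "B \<ge> 0"
  shows "cmod (fhat k f - (\<Sum>j<n. (1 / of_nat n * wave k (real j / real n)) * f (real j / real n)))
      \<le> l2norm (nderiv s f) * B"
proof -
  define q where "q = (\<lambda>h. k + h * int n)"
  define c where "c = (\<lambda>h. 2 * of_real pi * \<i> * complex_of_int (q h))"
  have fs: "sq_int (nderiv s f)" using f sobolev_sq_int [of f s s] by (simp add: periodic_sobolev_def)
  have partial: "cmod (\<Sum>h\<in>punctured N. fhat (q h) f) \<le> l2norm (nderiv s f) * B" for N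
  proof -
    define T where "T = (\<lambda>x. \<Sum>h\<in>punctured N. (1 / c h ^ s) * wave (q h) x)"
    have "((\<lambda>x. \<Sum>h\<in>punctured N. (1 / c h ^ s) * (nderiv s f x * wave (q h) x)) has_integral
        (\<Sum>h\<in>punctured N. (1 / c h ^ s) * fhat (q h) (nderiv s f))) {0..1}"
      by (intro has_integral_sum has_integral_mult_right fhat_has_integral fs) simp
    moreover have "(\<Sum>h\<in>punctured N. (1 / c h ^ s) * fhat (q h) (nderiv s f)) = (\<Sum>h\<in>punctured N. fhat (q h) f)"
    proof (intro sum.cong refl)
      fix h assume "h \<in> punctured N"
      then have "c h \<noteq> 0" using ne by (simp add: c_def q_def punctured_def del: of_int_add)
      moreover have "fhat (q h) (nderiv s f) = c h ^ s * fhat (q h) f"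
        unfolding c_def by (rule fhat_nderiv [OF f order_refl])
      ultimately show "(1 / c h ^ s) * fhat (q h) (nderiv s f) = fhat (q h) f" by simp
    qed
    moreover have "(\<Sum>h\<in>punctured N. (1 / c h ^ s) * (nderiv s f x * wave (q h) x)) = nderiv s f x * T x" for x
      by (simp add: T_def sum_distrib_left mult_ac)
    ultimately have "(\<Sum>h\<in>punctured N. fhat (q h) f) = integral {0..1} (\<lambda>x. nderiv s f x * T x)"
      by (simp add: integral_unique)
    also have "cmod \<dots> \<le> l2norm (nderiv s f) * l2norm T"
      unfolding T_def by (intro Cauchy_Schwarz_sq_int fs sq_int_continuous continuous_intros)
    also have "l2norm T = sqrt (\<Sum>h\<in>punctured N. (cmod (1 / c h ^ s))\<^sup>2)"
      unfolding T_def using n by (intro l2norm_trig_poly) (auto simp: q_def inj_on_def)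
    also have "\<dots> \<le> B"
    proof (intro real_le_lsqrt B)
      have "cmod (1 / c h ^ s) = 1 / (2 * pi * real_of_int \<bar>q h\<bar>) ^ s" for h
        unfolding norm_divide norm_power c_def cmod_fourier_factor by simp
      then show "(\<Sum>h\<in>punctured N. (cmod (1 / c h ^ s))\<^sup>2) \<le> B\<^sup>2"
        using B(1) [of N] by (simp only: q_def)
    qed
    finally show ?thesis by (simp add: mult_left_mono l2norm_nonneg)
  qed
  have "(\<lambda>N. cmod (\<Sum>h\<in>punctured N. fhat (q h) f)) \<longlonglongrightarrow>
      cmod ((\<Sum>j<n. (1 / of_nat n * wave k (real j / real n)) * f (real j / real n)) - fhat k f)"
    unfolding q_def by (intro tendsto_norm quadrature_aliasing [OF s f n])
  then have "cmod ((\<Sum>j<n. (1 / of_nat n * wave k (real j / real n)) * f (real j / real n)) - fhat k f)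
      \<le> l2norm (nderiv s f) * B"
    using partial by (intro LIMSEQ_le_const2) auto
  then show ?thesis by (simp only: norm_minus_commute)
qed

lemma sum_inverse_squares_le: "(\<Sum>j<N. 1 / (real j + 1)\<^sup>2) \<le> 2"
proof -
  have "(\<Sum>j<N. 1 / (real j + 1)\<^sup>2) \<le> pi\<^sup>2 / 6"
    using inverse_squares_sums sum_le_suminf [of "\<lambda>n. 1 / (real n + 1)\<^sup>2" "{..<N}"]
    by (auto simp: sums_iff add.commute)
  also have "pi\<^sup>2 \<le> 3.2\<^sup>2"
    using pi_approx by (intro power_mono) auto
  finally show ?thesis by (simp add: power2_eq_square)
qed

text \<open>For $m\ge3$ and $h\ne0$ one has $|h|(m-1)\ge2$, hence
  $|k+hn|\ge|k|(|h|m-1)\ge|k|\,|h|\,(m+1)/2$. In particular $k+hn\ne0$. The bound separates the dependence on \<open>h\<close>, and the remaining sum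
  $\sum_{h\ne0}|h|^{-2s}$ is at most $\sum_{h\ne0}h^{-2}\le4$.\<close>

lemma alias_sum_le:
  assumes s: "s \<ge> 1" and k: "k \<noteq> 0" and m: "m \<ge> (3::nat)"
  defines "n \<equiv> nat \<bar>k\<bar> * m"
  shows "(\<Sum>h\<in>punctured N. (1 / (2 * pi * real_of_int \<bar>k + h * int n\<bar>) ^ s)\<^sup>2)
      \<le> (2 * (2 / (2 * pi * real_of_int \<bar>k\<bar> * (real m + 1))) ^ s)\<^sup>2"
    and "h \<noteq> 0 \<Longrightarrow> k + h * int n \<noteq> 0"
proof -
  define K where "K = real_of_int \<bar>k\<bar>"
  define r where "r = 2 / (2 * pi * K * (real m + 1))"
  have K: "K \<ge> 1" using k by (simp add: K_def)
  have rn: "real n = K * real m" by (simp add: n_def K_def)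
  have low: "K * real_of_int \<bar>h\<bar> * (real m + 1) / 2 \<le> real_of_int \<bar>k + h * int n\<bar>" if "h \<noteq> 0" for h
  proof -
    have H: "real_of_int \<bar>h\<bar> \<ge> 1" using that by simp
    have "1 * 2 \<le> real_of_int \<bar>h\<bar> * (real m - 1)"
      using H m by (intro mult_mono) auto
    then have "real_of_int \<bar>h\<bar> * (real m + 1) / 2 \<le> real_of_int \<bar>h\<bar> * real m - 1"
      by (simp add: distrib_left right_diff_distrib add_divide_distrib)
    then have "K * (real_of_int \<bar>h\<bar> * (real m + 1) / 2) \<le> K * (real_of_int \<bar>h\<bar> * real m - 1)"
      using K by (intro mult_left_mono) auto
    also have "\<dots> = \<bar>real_of_int h * real n\<bar> - K"
      by (simp add: rn abs_mult K_def algebra_simps)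
    also have "\<dots> \<le> \<bar>real_of_int k + real_of_int h * real n\<bar>"
      unfolding K_def by (simp only: of_int_abs)
    also have "\<dots> = real_of_int \<bar>k + h * int n\<bar>" by simp
    finally show ?thesis by simp
  qed
  show ne: "k + h * int n \<noteq> 0" if "h \<noteq> 0" for h
  proof -
    have "0 < K * real_of_int \<bar>h\<bar> * (real m + 1) / 2" using K that by simp
    then have "0 < real_of_int \<bar>k + h * int n\<bar>" using low [OF that] by (rule less_le_trans)
    then show ?thesis by (metis abs_zero of_int_0 less_irrefl)
  qed
  have summand: "(1 / (2 * pi * real_of_int \<bar>k + h * int n\<bar>) ^ s)\<^sup>2 \<le> (r ^ s)\<^sup>2 * (1 / (real_of_int h)\<^sup>2)"
    if "h \<noteq> 0" for h
  proof -
    have H: "real_of_int \<bar>h\<bar> \<ge> 1" using that by simp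
    have pos: "0 < K * real_of_int \<bar>h\<bar> * (real m + 1) / 2" using K that by simp
    have "1 / (2 * pi * real_of_int \<bar>k + h * int n\<bar>) \<le> 1 / (2 * pi * (K * real_of_int \<bar>h\<bar> * (real m + 1) / 2))"
      using low [OF that] pos by (intro frac_le mult_left_mono) auto
    also have "\<dots> = r / real_of_int \<bar>h\<bar>" by (simp add: r_def)
    finally have "(1 / (2 * pi * real_of_int \<bar>k + h * int n\<bar>)) ^ s \<le> (r / real_of_int \<bar>h\<bar>) ^ s"
      by (intro power_mono) auto
    also have "\<dots> = r ^ s * (1 / real_of_int \<bar>h\<bar> ^ s)" by (simp add: power_divide)
    also have "\<dots> \<le> r ^ s * (1 / real_of_int \<bar>h\<bar>)"
      using H s K self_le_power [of "real_of_int \<bar>h\<bar>" s]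
      by (intro mult_left_mono divide_left_mono) (auto simp: r_def)
    finally have "(1 / (2 * pi * real_of_int \<bar>k + h * int n\<bar>)) ^ s \<le> r ^ s * (1 / real_of_int \<bar>h\<bar>)" .
    then have "((1 / (2 * pi * real_of_int \<bar>k + h * int n\<bar>)) ^ s)\<^sup>2 \<le> (r ^ s * (1 / real_of_int \<bar>h\<bar>))\<^sup>2"
      by (intro power_mono) auto
    then show ?thesis by (simp add: power_mult_distrib power_divide)
  qed
  have "(\<Sum>h\<in>punctured N. (1 / (2 * pi * real_of_int \<bar>k + h * int n\<bar>) ^ s)\<^sup>2)
      \<le> (\<Sum>h\<in>punctured N. (r ^ s)\<^sup>2 * (1 / (real_of_int h)\<^sup>2))"
    by (intro sum_mono summand) (simp add: punctured_def)
  also have "\<dots> = (r ^ s)\<^sup>2 * (2 * (\<Sum>j<N. 1 / (real j + 1)\<^sup>2))"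
  proof -
    have "(real_of_int (- (int j + 1)))\<^sup>2 = (real j + 1)\<^sup>2" for j
      by (simp add: power2_eq_square algebra_simps)
    then show ?thesis
      unfolding sum_distrib_left [symmetric] sum_punctured by (simp add: sum_distrib_left)
  qed
  also have "\<dots> \<le> (r ^ s)\<^sup>2 * (2 * 2)"
    using sum_inverse_squares_le by (intro mult_left_mono) auto
  also have "\<dots> = (2 * r ^ s)\<^sup>2" by (simp add: power_mult_distrib)
  finally show "(\<Sum>h\<in>punctured N. (1 / (2 * pi * real_of_int \<bar>k + h * int n\<bar>) ^ s)\<^sup>2)
      \<le> (2 * (2 / (2 * pi * real_of_int \<bar>k\<bar> * (real m + 1))) ^ s)\<^sup>2"
    by (simp add: r_def K_def)
qed

text \<open>The upper bound is the decay of the Fourier coefficients, and it is attained by a multiple of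
  $e^{2\pi ikx}$.\<close>

lemma minimal_error_0:
  assumes s: "s \<ge> 1" and k: "k \<noteq> 0"
  shows "minimal_error 0 k s = ereal (1 / (2 * pi * real_of_int \<bar>k\<bar>) ^ s)"
proof -
  define M where "M = (2 * pi * real_of_int \<bar>k\<bar>) ^ s"
  have M: "M > 0" using k by (simp add: M_def)
  have "algorithms s 0 = {\<lambda>f. 0}"
    by (auto simp: algorithms_def)
  then have "minimal_error 0 k s = worst_case_error s k (\<lambda>f. 0)"
    by (simp add: minimal_error_def)
  also have "\<dots> = ereal (1 / M)"
  proof (rule antisym)
    show "worst_case_error s k (\<lambda>f. 0) \<le> ereal (1 / M)"
      unfolding worst_case_error_def
    proof (rule SUP_least)
      fix f assume "f \<in> {f \<in> periodic_sobolev s. sobolev_norm s f \<le> 1}"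
      then have f: "f \<in> periodic_sobolev s" "f \<in> sobolev s" "sobolev_norm s f \<le> 1"
        by (auto simp: periodic_sobolev_def)
      have "cmod (fhat k f) \<le> l2norm (nderiv s f) / M"
        unfolding M_def by (rule fhat_le [OF f(1) k])
      also have "\<dots> \<le> 1 / M"
        using l2norm_nderiv_le [OF f(2,3)] M by (intro divide_right_mono) auto
      finally show "ereal (cmod (fourier_integral k f - 0)) \<le> ereal (1 / M)"
        using fourier_integral_eq_fhat [OF sobolev_sq_int [OF f(2), of 0]] by simp
    qed
    define f where "f = (\<lambda>x. of_real (1 / M) * wave (- k) x)"
    have f: "f \<in> periodic_sobolev s" "sobolev_norm s f = 1" "fhat k f = of_real (1 / M)"
      unfolding f_def M_def
      by (rule scaled_wave_periodic_sobolev [OF s] initial_error_attained [OF s k])+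
    have "ereal (cmod (fourier_integral k f - 0)) \<le> worst_case_error s k (\<lambda>f. 0)"
      unfolding worst_case_error_def using f by (intro SUP_upper) auto
    moreover have "fourier_integral k f = of_real (1 / M)"
      using f fourier_integral_eq_fhat [of f k] sobolev_sq_int [of f s 0]
      by (simp add: periodic_sobolev_def)
    ultimately show "ereal (1 / M) \<le> worst_case_error s k (\<lambda>f. 0)"
      using M by (simp add: norm_divide)
  qed
  finally show ?thesis by (simp only: M_def)
qed

text \<open>The algorithm is the rectangle rule for $f(x)e^{-2\pi ikx}$ with $n=|k|m$ equispaced nodes. Its
  error is at most $2(2/(m+1))^s$ times the initial error, and $2\cdot2^s\le\sqrt2\cdot3^s$ because
  $\sqrt2\le\frac32\le(\frac32)^s$.\<close>

lemma minimal_error_le: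
  assumes s: "s \<ge> 1" and k: "k \<noteq> 0" and m: "m \<ge> (3::nat)"
    and eps: "sqrt 2 * 3 ^ s \<le> \<epsilon> * (real m + 1) ^ s"
  shows "minimal_error (nat \<bar>k\<bar> * m) k s \<le> ereal (\<epsilon> * (1 / (2 * pi * real_of_int \<bar>k\<bar>) ^ s))"
proof -
  define n where "n = nat \<bar>k\<bar> * m"
  define M where "M = (2 * pi * real_of_int \<bar>k\<bar>) ^ s"
  define B where "B = 2 * (2 / (2 * pi * real_of_int \<bar>k\<bar> * (real m + 1))) ^ s"
  define A where "A = (\<lambda>f. \<Sum>j=1..n. (1 / of_nat n * wave k (real (j - 1) / real n)) * nderiv 0 f (real (j - 1) / real n))"
  have n: "n > 0" using k m by (simp add: n_def)
  have M: "M > 0" using k by (simp add: M_def)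
  have B: "B \<ge> 0" "B \<le> \<epsilon> * (1 / M)"
  proof -
    show "B \<ge> 0" by (simp add: B_def)
    have "sqrt 2 \<le> 3 / 2" by (rule real_le_lsqrt) (auto simp: power2_eq_square)
    also have "(3 / 2 :: real) \<le> (3 / 2) ^ s" using s by (intro self_le_power) auto
    finally have "sqrt 2 * sqrt 2 * 2 ^ s \<le> sqrt 2 * (3 / 2) ^ s * 2 ^ s"
      by (intro mult_right_mono mult_left_mono) auto
    then have "2 * 2 ^ s \<le> sqrt 2 * 3 ^ s" by (simp add: power_divide)
    also note eps
    finally have "2 * 2 ^ s / (real m + 1) ^ s \<le> \<epsilon>" by (simp add: pos_divide_le_eq)
    then have "2 * 2 ^ s / (real m + 1) ^ s * (1 / M) \<le> \<epsilon> * (1 / M)"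
      using M by (intro mult_right_mono) auto
    moreover have "B = 2 * 2 ^ s / (real m + 1) ^ s * (1 / M)"
      unfolding B_def M_def power_divide
        power_mult_distrib [of "2 * pi * real_of_int \<bar>k\<bar>" "real m + 1"] by simp
    ultimately show "B \<le> \<epsilon> * (1 / M)" by simp
  qed
  have "A \<in> algorithms s n"
    unfolding algorithms_def A_def using s
    by (intro CollectI exI [of _ "\<lambda>j. 1 / of_nat n * wave k (real (j - 1) / real n)"] exI [of _ "\<lambda>j. 0"]
        exI [of _ "\<lambda>j. real (j - 1) / real n"]) auto
  then have "minimal_error n k s \<le> worst_case_error s k A"
    unfolding minimal_error_def by (rule INF_lower)
  also have "\<dots> \<le> ereal (\<epsilon> * (1 / M))"
    unfolding worst_case_error_def
  proof (rule SUP_least)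
    fix f assume "f \<in> {f \<in> periodic_sobolev s. sobolev_norm s f \<le> 1}"
    then have f: "f \<in> periodic_sobolev s" "f \<in> sobolev s" "sobolev_norm s f \<le> 1"
      by (auto simp: periodic_sobolev_def)
    have "A f = (\<Sum>j<n. (1 / of_nat n * wave k (real j / real n)) * f (real j / real n))"
      by (simp add: A_def sum.atLeast1_atMost_eq)
    then have "cmod (fhat k f - A f) \<le> l2norm (nderiv s f) * B"
      using quadrature_error_le [OF s f(1) n, of k B] alias_sum_le [OF s k m] B(1)
      unfolding n_def B_def by simp
    also have "\<dots> \<le> 1 * B" using l2norm_nderiv_le [OF f(2,3)] B(1) by (intro mult_right_mono)
    also have "\<dots> \<le> \<epsilon> * (1 / M)" using B(2) by simp
    finally show "ereal (cmod (fourier_integral k f - A f)) \<le> ereal (\<epsilon> * (1 / M))"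
      using fourier_integral_eq_fhat [OF sobolev_sq_int [OF f(2), of 0]] by simp
  qed
  finally show ?thesis by (simp only: n_def M_def)
qed

text \<open>For the upper bound $m=\lceil 3y-1\rceil$ with $y=(\sqrt2/\varepsilon)^{1/s}$ is the least integer
  with $m+1\ge3y$, and $m\ge3$ because $y>1$. That this \<open>m\<close> gives an admissible number of nodes also shows
  that the minimum defining the complexity is taken over a nonempty set, which the lower bound relies on.\<close>

lemma info_complexity_bounds:
  assumes s: "s \<ge> 1" and c: "c > 0"
    and lower: "\<And>(k::int) (n::nat). n \<ge> 1 \<Longrightarrow>
           ereal (c / (real n + real_of_int \<bar>k\<bar>) ^ s) \<le> minimal_error n k s"
    and k: "k \<noteq> 0" and \<epsilon>: "0 < \<epsilon>" "\<epsilon> < 1"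
  shows "real_of_int \<bar>k\<bar> * (2 * pi * (c / \<epsilon>) powr (1 / real s) - 1)
              \<le> real (info_complexity_nor \<epsilon> k s)"
    and "real (info_complexity_nor \<epsilon> k s)
              \<le> real_of_int \<bar>k\<bar> * real_of_int \<lceil>3 * (sqrt 2 / \<epsilon>) powr (1 / real s) - 1\<rceil>"
proof -
  define K where "K = real_of_int \<bar>k\<bar>"
  define M where "M = (2 * pi * K) ^ s"
  have K: "K \<ge> 1" using k by (simp add: K_def)
  have M: "M > 0" using K by (simp add: M_def)
  have e0: "minimal_error 0 k s = ereal (1 / M)"
    using minimal_error_0 [OF s k] by (simp add: M_def K_def)
  have root: "(a powr (1 / real s)) ^ s = a" if "a > 0" for a
    using that s by (simp add: powr_realpow [symmetric] powr_powr)
  define y where "y = (sqrt 2 / \<epsilon>) powr (1 / real s)"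
  have "sqrt 2 / \<epsilon> > 1" using \<epsilon> by (simp add: less_divide_eq) (smt (verit) real_sqrt_gt_1_iff)
  then have y1: "y > 1" unfolding y_def using s by (intro gr_one_powr) auto
  have ys: "y ^ s = sqrt 2 / \<epsilon>" unfolding y_def using \<epsilon> by (intro root) simp
  define m where "m = nat \<lceil>3 * y - 1\<rceil>"
  have m3: "m \<ge> 3" and my: "real m \<ge> 3 * y - 1" and rm: "real_of_int \<lceil>3 * y - 1\<rceil> = real m"
    using y1 by (auto simp: m_def) linarith+
  have "(3 * y) ^ s \<le> (real m + 1) ^ s" using my y1 by (intro power_mono) auto
  then have "sqrt 2 * 3 ^ s \<le> \<epsilon> * (real m + 1) ^ s"
    using \<epsilon> by (simp add: power_mult_distrib ys pos_divide_le_eq mult_ac)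
  from minimal_error_le [OF s k m3 this]
  have ok: "minimal_error (nat \<bar>k\<bar> * m) k s \<le> ereal \<epsilon> * minimal_error 0 k s"
    by (simp add: e0 M_def K_def)
  then have "info_complexity_nor \<epsilon> k s \<le> nat \<bar>k\<bar> * m"
    unfolding info_complexity_nor_def by (rule Least_le)
  then have "real (info_complexity_nor \<epsilon> k s) \<le> real (nat \<bar>k\<bar> * m)" by (rule of_nat_mono)
  then show "real (info_complexity_nor \<epsilon> k s)
              \<le> real_of_int \<bar>k\<bar> * real_of_int \<lceil>3 * (sqrt 2 / \<epsilon>) powr (1 / real s) - 1\<rceil>"
    using rm by (simp add: y_def)
  define n where "n = info_complexity_nor \<epsilon> k s"
  have least: "minimal_error n k s \<le> ereal (\<epsilon> / M)"
    unfolding n_def info_complexity_nor_def using LeastI [of "\<lambda>n. minimal_error n k s \<le> ereal \<epsilon> * minimal_error 0 k s", OF ok]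
    by (simp add: e0)
  \<comment> \<open>The assumed lower bound speaks about \<open>n \<ge> 1\<close> only; \<open>n = 0\<close> is impossible since the initial
      error is positive and \<open>\<epsilon> < 1\<close>.\<close>
  have "n \<noteq> 0"
  proof
    assume "n = 0"
    then have "1 / M \<le> \<epsilon> / M" using least e0 by simp
    then show False using M \<epsilon> by (simp add: divide_le_cancel)
  qed
  then have "n \<ge> 1" by simp
  then have "ereal (c / (real n + K) ^ s) \<le> ereal (\<epsilon> / M)"
    unfolding K_def by (rule order_trans [OF lower least])
  then have "c / (real n + K) ^ s \<le> \<epsilon> / M" by simp
  then have "M * (c / \<epsilon>) \<le> (real n + K) ^ s"
    using M \<epsilon> K by (simp add: field_simps)
  then have "(2 * pi * K * (c / \<epsilon>) powr (1 / real s)) ^ s \<le> (real n + K) ^ s"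
    using c \<epsilon> unfolding M_def power_mult_distrib [of "2 * pi * K"] by (simp add: root)
  then have "2 * pi * K * (c / \<epsilon>) powr (1 / real s) \<le> real n + K"
    using K s by (simp add: power_mono_iff)
  then show "real_of_int \<bar>k\<bar> * (2 * pi * (c / \<epsilon>) powr (1 / real s) - 1)
              \<le> real (info_complexity_nor \<epsilon> k s)"
    unfolding n_def [symmetric] K_def [symmetric] by (simp add: algebra_simps)
qed

theorem corollary11:
  fixes s :: nat and c :: real
  assumes "s \<ge> 1" and "c > 0"
    and "\<And>(k::int) (n::nat). n \<ge> 1 \<Longrightarrow>
           ereal (c / (real n + real_of_int \<bar>k\<bar>) ^ s) \<le> minimal_error n k s"
  shows "(\<forall>(k::int) (\<epsilon>::real). k \<noteq> 0 \<longrightarrow> 0 < \<epsilon> \<longrightarrow> \<epsilon> < 1 \<longrightarrow>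
            real_of_int \<bar>k\<bar> * (2 * pi * (c / \<epsilon>) powr (1 / real s) - 1)
              \<le> real (info_complexity_nor \<epsilon> k s) \<and>
            real (info_complexity_nor \<epsilon> k s)
              \<le> real_of_int \<bar>k\<bar> * real_of_int \<lceil>3 * (sqrt 2 / \<epsilon>) powr (1 / real s) - 1\<rceil>)
       \<and> (\<exists>C\<^sub>1>0. \<exists>C\<^sub>2>0. \<forall>k::int. k \<noteq> 0 \<longrightarrow>
            (\<forall>\<^sub>F \<epsilon> in at_right (0::real).
               C\<^sub>1 * (real_of_int \<bar>k\<bar> / \<epsilon> powr (1 / real s)) \<le> real (info_complexity_nor \<epsilon> k s) \<and>
               real (info_complexity_nor \<epsilon> k s) \<le> C\<^sub>2 * (real_of_int \<bar>k\<bar> / \<epsilon> powr (1 / real s))))"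
proof -
  have bounds: "real_of_int \<bar>k\<bar> * (2 * pi * (c / \<epsilon>) powr (1 / real s) - 1) \<le> real (info_complexity_nor \<epsilon> k s)"
      "real (info_complexity_nor \<epsilon> k s)
         \<le> real_of_int \<bar>k\<bar> * real_of_int \<lceil>3 * (sqrt 2 / \<epsilon>) powr (1 / real s) - 1\<rceil>"
    if "k \<noteq> 0" "0 < \<epsilon>" "\<epsilon> < 1" for k \<epsilon>
    by (rule info_complexity_bounds [OF assms(1,2) _ that]; rule assms(3); assumption)+
  define C1 where "C1 = pi * c powr (1 / real s)"
  define C2 where "C2 = 3 * sqrt 2 powr (1 / real s)"
  have C: "C1 > 0" "C2 > 0" using assms(2) by (auto simp: C1_def C2_def)
  have "C1 * (real_of_int \<bar>k\<bar> / \<epsilon> powr (1 / real s)) \<le> real (info_complexity_nor \<epsilon> k s) \<and>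
        real (info_complexity_nor \<epsilon> k s) \<le> C2 * (real_of_int \<bar>k\<bar> / \<epsilon> powr (1 / real s))"
    if k: "k \<noteq> 0" and e: "0 < \<epsilon>" "\<epsilon> < min 1 c" for k \<epsilon>
    \<comment> \<open>For \<open>\<epsilon> < c\<close> the term \<open>- 1\<close> in the lower bound costs at most half of the main term.\<close>
  proof
    have e1: "0 < \<epsilon>" "\<epsilon> < 1" using e by auto
    define t where "t = (c / \<epsilon>) powr (1 / real s)"
    have "t \<ge> 1" unfolding t_def using e assms(2) by (intro ge_one_powr_ge_zero) auto
    then have "pi * t \<ge> 1 * 1" using pi_ge_two by (intro mult_mono) auto
    then have "pi * t \<le> 2 * pi * t - 1" by simp
    then have "real_of_int \<bar>k\<bar> * (pi * t) \<le> real_of_int \<bar>k\<bar> * (2 * pi * t - 1)"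
      by (intro mult_left_mono) auto
    also have "\<dots> \<le> real (info_complexity_nor \<epsilon> k s)" unfolding t_def by (rule bounds(1) [OF k e1])
    finally show "C1 * (real_of_int \<bar>k\<bar> / \<epsilon> powr (1 / real s)) \<le> real (info_complexity_nor \<epsilon> k s)"
      using e assms(2) by (simp add: C1_def t_def powr_divide mult_ac)
    have "real (info_complexity_nor \<epsilon> k s)
        \<le> real_of_int \<bar>k\<bar> * real_of_int \<lceil>3 * (sqrt 2 / \<epsilon>) powr (1 / real s) - 1\<rceil>"
      by (rule bounds(2) [OF k e1])
    also have "\<dots> \<le> real_of_int \<bar>k\<bar> * (3 * (sqrt 2 / \<epsilon>) powr (1 / real s))"
      by (intro mult_left_mono) linarith+
    finally show "real (info_complexity_nor \<epsilon> k s) \<le> C2 * (real_of_int \<bar>k\<bar> / \<epsilon> powr (1 / real s))"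
      using e by (simp add: C2_def powr_divide mult_ac)
  qed
  then have theta: "\<forall>\<^sub>F \<epsilon> in at_right (0::real).
       C1 * (real_of_int \<bar>k\<bar> / \<epsilon> powr (1 / real s)) \<le> real (info_complexity_nor \<epsilon> k s) \<and>
       real (info_complexity_nor \<epsilon> k s) \<le> C2 * (real_of_int \<bar>k\<bar> / \<epsilon> powr (1 / real s))"
    if "k \<noteq> 0" for k
    unfolding eventually_at_right_field using that assms(2) by (intro exI [of _ "min 1 c"]) simp
  show ?thesis
    by (intro conjI allI impI exI [of _ C1] exI [of _ C2]) (fact bounds C theta)+
qed

end
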